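(* Let $X$ be a union of conjugacy classes of a group regarded as a rack, assumed braided, $q$ a two-cocycle, $V=\Bbbk X$ the realization over $\Bbbk G_X$, and assume $\mathcal B(V)$ is slim in degree two. Let $a,b,c,d\in X$ be pairwise distinct and pairwise not commuting except that $a\triangleright c=c$, and assume $b\triangleright(c\triangleright d)=c\triangleright d\ne b$ and $a\triangleright(b\triangleright d)=b\triangleright d\ne a$. Put $e=a\triangleright(b\triangleright(c\triangleright d))$, $f=e\triangleright(a\triangleright(b\triangleright c))$, $g=f\triangleright(e\triangleright(a\triangleright b))$, $$Z=\mu(\mathrm{id}-c_1c_2c_3+(c_1c_2c_3)^2-(c_1c_2c_3)^3)(v_a\otimes v_b\otimes v_c\otimes v_d),$$ $S=\{v_b,v_c,v_d,v_e,v_f,v_g\}$, and let $C$ be the subalgebra generated by $S\cup\{Z\}$. Then (1) $C$ is a left coideal subalgebra of $\mathcal B(V)$ in the category of $\mathbb N_0$-graded $\Bbbk G_X$-comodules; (2) if $e\ne d$ or $f\ne c$ or $g\ne b$, then $C$ is not generated in degree one.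
   Context: $\Bbbk$ algebraically closed of characteristic $0$. Rack, braided rack (quandle with, for all $x,y$, $x\triangleright y=y$ or $x\triangleright(y\triangleright x)=y$), two-cocycle ($q_{x\triangleright y,x\triangleright z}q_{x,z}=q_{x,y\triangleright z}q_{y,z}$), $G_X=\langle g_x\mid g_xg_y=g_{x\triangleright y}g_x\rangle$. Realization: $V=\Bbbk X$, basis $v_x$, $\deg v_x=g_x$, $g_x\cdot v_y=q_{x,y}v_{x\triangleright y}$, braiding $c_q(v_x\otimes v_y)=q_{x,y}v_{x\triangleright y}\otimes v_x$. On $V^{\otimes n}$, $c_i$ is $c_q$ applied at factors $i,i+1$; $\mu$ is multiplication of the Nichols algebra $\mathcal B(V)$. $x,y$ commute if $x\triangleright y=y$. $\mathcal B(V)$ is slim in degree two if $\mu(\mathrm{id}-c_q)(v_a\otimes v_b)=0$ whenever $a\triangleright b=b\ne a$ and $\mu(\mathrm{id}-c_q+c_q^2)(v_a\otimes v_b)=0$ whenever $a\triangleright b\ne b$. Left coideal subalgebra in the category of $\mathbb N_0$-graded $\Bbbk G_X$-comodules: $\mathbb N_0$-graded $G_X$-graded subalgebra $C\ni1$ with $\Delta(C)\subseteq\mathcal B(V)\otimes C$; generated in degree one: generated by $C\cap V$. *)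

theory Defs
  imports "HOL-Algebra.Group" "HOL-Computational_Algebra.Polynomial"
begin

text \<open>Model of the tensor algebra T(V), V = k X: an element is a function
  from words (lists over X) to k with finite support; the word x1...xn stands
  for v_x1 (x) ... (x) v_xn.  The Nichols algebra B(V) is realized (Rosso /
  Schauenburg) as the image of the quantum symmetrizer mu : T(V) -> T(V),
  i.e. as the subalgebra of the quantum shuffle algebra generated by V; its
  coproduct is deconcatenation.\<close>

definition rconj :: "('g, 'm) monoid_scheme \<Rightarrow> 'g \<Rightarrow> 'g \<Rightarrow> 'g" where
  "rconj G x y = x \<otimes>\<^bsub>G\<^esub> y \<otimes>\<^bsub>G\<^esub> inv\<^bsub>G\<^esub> x"

definition delta :: "'a list \<Rightarrow> 'a list \<Rightarrow> 'k::zero_neq_one" where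
  "delta w = (\<lambda>u. if u = w then 1 else 0)"

definition fins :: "'a set \<Rightarrow> ('a list \<Rightarrow> 'k::zero) \<Rightarrow> bool" where
  "fins X f \<longleftrightarrow> finite {u. f u \<noteq> 0} \<and> (\<forall>u. f u \<noteq> 0 \<longrightarrow> set u \<subseteq> X)"

definition lin :: "('a list \<Rightarrow> 'a list \<Rightarrow> 'k::comm_ring_1) \<Rightarrow> ('a list \<Rightarrow> 'k) \<Rightarrow> 'a list \<Rightarrow> 'k" where
  "lin F f = (\<lambda>u. \<Sum>w\<in>{w. f w \<noteq> 0}. f w * F w u)"

definition braidw :: "('a \<Rightarrow> 'a \<Rightarrow> 'a) \<Rightarrow> ('a \<Rightarrow> 'a \<Rightarrow> 'k::comm_ring_1) \<Rightarrow> nat \<Rightarrow> 'a list \<Rightarrow> 'a list \<Rightarrow> 'k" where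
  "braidw rk q i w = (if 1 \<le> i \<and> i < length w
     then (\<lambda>u. q (w!(i-1)) (w!i) * delta (w[i-1 := rk (w!(i-1)) (w!i), i := w!(i-1)]) u)
     else (\<lambda>u. 0))"

definition cmap :: "('a \<Rightarrow> 'a \<Rightarrow> 'a) \<Rightarrow> ('a \<Rightarrow> 'a \<Rightarrow> 'k::comm_ring_1) \<Rightarrow> nat \<Rightarrow> ('a list \<Rightarrow> 'k) \<Rightarrow> 'a list \<Rightarrow> 'k" where
  "cmap rk q i = lin (braidw rk q i)"

fun Lk :: "('a \<Rightarrow> 'a \<Rightarrow> 'a) \<Rightarrow> ('a \<Rightarrow> 'a \<Rightarrow> 'k::comm_ring_1) \<Rightarrow> nat \<Rightarrow> ('a list \<Rightarrow> 'k) \<Rightarrow> 'a list \<Rightarrow> 'k" where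
  "Lk rk q 0 f = f"
| "Lk rk q (Suc k) f = cmap rk q (Suc k) (Lk rk q k f)"

definition Tsum :: "('a \<Rightarrow> 'a \<Rightarrow> 'a) \<Rightarrow> ('a \<Rightarrow> 'a \<Rightarrow> 'k::comm_ring_1) \<Rightarrow> nat \<Rightarrow> ('a list \<Rightarrow> 'k) \<Rightarrow> 'a list \<Rightarrow> 'k" where
  "Tsum rk q n f = (\<lambda>u. \<Sum>k\<le>n. Lk rk q k f u)"

definition prep :: "'a \<Rightarrow> ('a list \<Rightarrow> 'k::zero) \<Rightarrow> 'a list \<Rightarrow> 'k" where
  "prep x f = (\<lambda>u. if u \<noteq> [] \<and> hd u = x then f (tl u) else 0)"

text \<open>quantum symmetrizer on basis words:
  Omega(x w) = (id + c_1 + c_2 c_1 + ... + c_n ... c_1)(v_x (x) Omega(w)),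
  i.e. the iterated quantum shuffle product v_x1 ... v_xn\<close>
fun omegaw :: "('a \<Rightarrow> 'a \<Rightarrow> 'a) \<Rightarrow> ('a \<Rightarrow> 'a \<Rightarrow> 'k::comm_ring_1) \<Rightarrow> 'a list \<Rightarrow> 'a list \<Rightarrow> 'k" where
  "omegaw rk q [] = delta []"
| "omegaw rk q (x # w) = Tsum rk q (length w) (prep x (omegaw rk q w))"

text \<open>mu : T(V) -> B(V), the multiplication of the Nichols algebra\<close>
definition nmu :: "('a \<Rightarrow> 'a \<Rightarrow> 'a) \<Rightarrow> ('a \<Rightarrow> 'a \<Rightarrow> 'k::comm_ring_1) \<Rightarrow> ('a list \<Rightarrow> 'k) \<Rightarrow> 'a list \<Rightarrow> 'k" where
  "nmu rk q f = lin (omegaw rk q) f"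

definition nichols :: "'a set \<Rightarrow> ('a \<Rightarrow> 'a \<Rightarrow> 'a) \<Rightarrow> ('a \<Rightarrow> 'a \<Rightarrow> 'k::comm_ring_1) \<Rightarrow> ('a list \<Rightarrow> 'k) set" where
  "nichols X rk q = {nmu rk q f | f. fins X f}"

definition tens :: "('a list \<Rightarrow> 'k::comm_ring_1) \<Rightarrow> ('a list \<Rightarrow> 'k) \<Rightarrow> 'a list \<Rightarrow> 'k" where
  "tens f g = (\<lambda>u. \<Sum>i\<le>length u. f (take i u) * g (drop i u))"

definition tensl :: "('a list \<Rightarrow> 'k::comm_ring_1) list \<Rightarrow> 'a list \<Rightarrow> 'k" where
  "tensl ws = foldr tens ws (delta [])"

definition spanK :: "('b \<Rightarrow> 'k::comm_ring_1) set \<Rightarrow> ('b \<Rightarrow> 'k) set" where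
  "spanK A = {h. \<exists>(n::nat) coef fs. (\<forall>j<n. fs j \<in> A) \<and> h = (\<lambda>u. \<Sum>j<n. coef j * fs j u)}"

text \<open>The enveloping group G_X = < g_x | g_x g_y = g_(x|>y) g_x >, presented as
  a congruence on words in letters (x, True) = g_x and (x, False) = g_x^-1.\<close>
inductive gcong :: "'a set \<Rightarrow> ('a \<Rightarrow> 'a \<Rightarrow> 'a) \<Rightarrow> ('a \<times> bool) list \<Rightarrow> ('a \<times> bool) list \<Rightarrow> bool"
  for X rk where
  grefl: "gcong X rk u u"
| gsym: "gcong X rk u w \<Longrightarrow> gcong X rk w u"
| gtrans: "gcong X rk u w \<Longrightarrow> gcong X rk w z \<Longrightarrow> gcong X rk u z"
| gctx: "gcong X rk u w \<Longrightarrow> gcong X rk (l @ u @ r) (l @ w @ r)"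
| gcanc1: "x \<in> X \<Longrightarrow> gcong X rk [(x, True), (x, False)] []"
| gcanc2: "x \<in> X \<Longrightarrow> gcong X rk [(x, False), (x, True)] []"
| grel: "x \<in> X \<Longrightarrow> y \<in> X \<Longrightarrow> gcong X rk [(x, True), (y, True)] [(rk x y, True), (x, True)]"

definition gxeq :: "'a set \<Rightarrow> ('a \<Rightarrow> 'a \<Rightarrow> 'a) \<Rightarrow> 'a list \<Rightarrow> 'a list \<Rightarrow> bool" where
  "gxeq X rk u w = gcong X rk (map (\<lambda>x. (x, True)) u) (map (\<lambda>x. (x, True)) w)"

definition ncomp :: "nat \<Rightarrow> ('a list \<Rightarrow> 'k::zero) \<Rightarrow> 'a list \<Rightarrow> 'k" where
  "ncomp n p = (\<lambda>u. if length u = n then p u else 0)"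

definition gcomp :: "'a set \<Rightarrow> ('a \<Rightarrow> 'a \<Rightarrow> 'a) \<Rightarrow> 'a list \<Rightarrow> ('a list \<Rightarrow> 'k::zero) \<Rightarrow> 'a list \<Rightarrow> 'k" where
  "gcomp X rk w0 p = (\<lambda>u. if gxeq X rk u w0 then p u else 0)"

text \<open>coproduct = deconcatenation, with values in T(V) (x) T(V)
  = functions on pairs of words\<close>
definition coprod :: "('a list \<Rightarrow> 'k) \<Rightarrow> 'a list \<times> 'a list \<Rightarrow> 'k" where
  "coprod p = (\<lambda>(u, w). p (u @ w))"

definition ptens :: "('a list \<Rightarrow> 'k::comm_ring_1) \<Rightarrow> ('a list \<Rightarrow> 'k) \<Rightarrow> 'a list \<times> 'a list \<Rightarrow> 'k" where
  "ptens x y = (\<lambda>(u, w). x u * y w)"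

definition left_coideal_subalg :: "'a set \<Rightarrow> ('a \<Rightarrow> 'a \<Rightarrow> 'a) \<Rightarrow> ('a \<Rightarrow> 'a \<Rightarrow> 'k::comm_ring_1) \<Rightarrow> ('a list \<Rightarrow> 'k) set \<Rightarrow> bool" where
  "left_coideal_subalg X rk q C \<longleftrightarrow>
     C \<subseteq> nichols X rk q
   \<and> delta [] \<in> C
   \<and> (\<forall>p\<in>C. \<forall>r\<in>C. (\<lambda>u. p u + r u) \<in> C)
   \<and> (\<forall>p\<in>C. \<forall>s. (\<lambda>u. s * p u) \<in> C)
   \<and> (\<forall>f g. fins X f \<longrightarrow> fins X g \<longrightarrow> nmu rk q f \<in> C \<longrightarrow> nmu rk q g \<in> C
          \<longrightarrow> nmu rk q (tens f g) \<in> C)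
   \<and> (\<forall>p\<in>C. \<forall>n. ncomp n p \<in> C)
   \<and> (\<forall>p\<in>C. \<forall>w0. gcomp X rk w0 p \<in> C)
   \<and> (\<forall>p\<in>C. coprod p \<in> spanK {ptens x y | x y. x \<in> nichols X rk q \<and> y \<in> C})"

definition gen_deg_one :: "('a \<Rightarrow> 'a \<Rightarrow> 'a) \<Rightarrow> ('a \<Rightarrow> 'a \<Rightarrow> 'k::comm_ring_1) \<Rightarrow> ('a list \<Rightarrow> 'k) set \<Rightarrow> bool" where
  "gen_deg_one rk q C \<longleftrightarrow>
     C = spanK {nmu rk q (tensl ws) | ws. set ws \<subseteq> {h \<in> C. \<forall>u. h u \<noteq> 0 \<longrightarrow> length u = 1}}"

definition slim2 :: "'a set \<Rightarrow> ('a \<Rightarrow> 'a \<Rightarrow> 'a) \<Rightarrow> ('a \<Rightarrow> 'a \<Rightarrow> 'k::comm_ring_1) \<Rightarrow> bool" where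
  "slim2 X rk q \<longleftrightarrow>
    (\<forall>a\<in>X. \<forall>b\<in>X. rk a b = b \<and> b \<noteq> a \<longrightarrow>
       nmu rk q (\<lambda>u. delta [a, b] u - cmap rk q 1 (delta [a, b]) u) = (\<lambda>u. 0))
  \<and> (\<forall>a\<in>X. \<forall>b\<in>X. rk a b \<noteq> b \<longrightarrow>
       nmu rk q (\<lambda>u. delta [a, b] u - cmap rk q 1 (delta [a, b]) u
                      + cmap rk q 1 (cmap rk q 1 (delta [a, b])) u) = (\<lambda>u. 0))"

definition twococycle :: "'a set \<Rightarrow> ('a \<Rightarrow> 'a \<Rightarrow> 'a) \<Rightarrow> ('a \<Rightarrow> 'a \<Rightarrow> 'k::field) \<Rightarrow> bool" where
  "twococycle X rk q \<longleftrightarrow> (\<forall>x\<in>X. \<forall>y\<in>X. q x y \<noteq> 0) \<and>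
     (\<forall>x\<in>X. \<forall>y\<in>X. \<forall>z\<in>X. q (rk x y) (rk x z) * q x z = q x (rk y z) * q y z)"

definition Ztens :: "('a \<Rightarrow> 'a \<Rightarrow> 'a) \<Rightarrow> ('a \<Rightarrow> 'a \<Rightarrow> 'k::comm_ring_1) \<Rightarrow> 'a \<Rightarrow> 'a \<Rightarrow> 'a \<Rightarrow> 'a \<Rightarrow> 'a list \<Rightarrow> 'k" where
  "Ztens rk q a b c d =
    (let P = cmap rk q 1 \<circ> cmap rk q 2 \<circ> cmap rk q 3; v = delta [a, b, c, d]
     in (\<lambda>u. v u - P v u + (P ^^ 2) v u - (P ^^ 3) v u))"

end

theory Submission
  imports Defs
begin

text \<open>A subspace of \<open>\<B>(V)\<close> is a left coideal as soon as it is stable under the left skew derivations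
  \<open>\<partial>\<^sub>x\<close> (the components of the coproduct in \<open>V \<otimes> \<B>(V)\<close>). Write \<open>P = c\<^sub>1 c\<^sub>2 c\<^sub>3\<close>. The derivative of \<open>Z\<close> is governed by
  \<open>(1 + c\<^sub>1 + c\<^sub>1 c\<^sub>2 + P)(1 - P + P\<^sup>2 - P\<^sup>3)\<close>: the part \<open>(1 + P)(\<dots>) = 1 - P\<^sup>4\<close> only leaves \<open>b c d\<close> and
  \<open>g f e\<close>, and in the remaining part the terms containing \<open>a\<close> are grouped by their left tensor factor,
  \<open>a \<triangleright> b\<close> or \<open>a \<triangleright> (b \<triangleright> c)\<close>; the quadratic relations rewrite the two groups as multiples of \<open>c d g\<close>
  and \<open>d g f\<close>.

  For the second claim consider the coefficient of the word \<open>a b c d\<close>. It vanishes on all products of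
  letters \<open>b\<close>, \<open>c\<close>, \<open>d\<close>, \<open>e\<close>, \<open>f\<close>, \<open>g\<close>, since undoing the braidings that lead to \<open>a b c d\<close> always
  produces a letter outside this set, but it is \<open>1\<close> on \<open>Z\<close> unless \<open>e = d\<close>, \<open>f = c\<close> and \<open>g = b\<close>.\<close>

section \<open>Spans\<close>

text \<open>The product is easiest to control from the right: carrying a letter to the right past a
  factor only applies the action of that letter to the factor, so \<open>qsh\<close> is built from
  right derivations. Left derivations, which the coideal condition needs, obey a Leibniz rule
  twisted by the degree of the left factor. Every generator, \<open>Z\<close> included, must
  therefore be homogeneous in a strong sense: the words whose symmetrizations form it share one
  degree in the enveloping group and act on \<open>V\<close> by the same permutation with the same
  scalars.

  Slimness enters twice. It rewrites symmetrized words, and reading off one coefficient of each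
  quadratic relation gives \<open>q x y * q y x = 1\<close> for distinct commuting pairs and a
  triple product equal to -1 for noncommuting pairs. With the cocycle condition these scalars make
  the terms containing \<open>a\<close> cancel.

  The letters \<open>e\<close>, \<open>f\<close>, \<open>g\<close> are those that \<open>P\<close>
  successively brings to the front. The two commutation hypotheses collapse them to
  \<open>e = rk a (rk c d)\<close>, \<open>f = rk b d\<close>, \<open>g = rk a d\<close>, which
  keeps the rack computations short.\<close>

lemma spanK_zero: "(\<lambda>u. 0) \<in> spanK A"
  unfolding spanK_def by (rule CollectI, rule exI[of _ 0]) auto

lemma spanK_base:
  assumes "f \<in> A" shows "f \<in> spanK A"
  unfolding spanK_def
  by (rule CollectI, rule exI[of _ 1], rule exI[of _ "\<lambda>_. 1"], rule exI[of _ "\<lambda>_. f"]) (use assms in auto)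

lemma spanK_smul:
  assumes "p \<in> spanK A" shows "(\<lambda>u. s * p u) \<in> spanK A"
proof -
  obtain n :: nat and cf fs where "\<forall>j<n. fs j \<in> A" and p: "p = (\<lambda>u. \<Sum>j<n. cf j * fs j u)"
    using assms unfolding spanK_def by blast
  then have "(\<forall>j<n. fs j \<in> A) \<and> (\<lambda>u. s * p u) = (\<lambda>u. \<Sum>j<n. (s * cf j) * fs j u)"
    by (simp add: sum_distrib_left mult.assoc)
  then show ?thesis
    unfolding spanK_def by (intro CollectI exI[of _ n] exI[of _ "\<lambda>j. s * cf j"] exI[of _ fs])
qed

lemma spanK_add:
  assumes "p \<in> spanK A" "r \<in> spanK A" shows "(\<lambda>u. p u + r u) \<in> spanK A"
proof -
  obtain n :: nat and cf fs where n: "\<forall>j<n. fs j \<in> A" and p: "p = (\<lambda>u. \<Sum>j<n. cf j * fs j u)"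
    using assms(1) unfolding spanK_def by blast
  obtain m :: nat and cg gs where m: "\<forall>j<m. gs j \<in> A" and r: "r = (\<lambda>u. \<Sum>j<m. cg j * gs j u)"
    using assms(2) unfolding spanK_def by blast
  define c where "c j = (if j < n then cf j else cg (j - n))" for j
  define h where "h j = (if j < n then fs j else gs (j - n))" for j
  have "(\<Sum>j<n+m. c j * h j u) = p u + r u" for u
  proof -
    have "(\<Sum>j<n+m. c j * h j u) = (\<Sum>j<n. c j * h j u) + (\<Sum>j<m. c (n + j) * h (n + j) u)"
      by (induction m) (auto simp: algebra_simps)
    then show ?thesis by (simp add: p r c_def h_def)
  qed
  then have "(\<lambda>u. p u + r u) = (\<lambda>u. \<Sum>j<n+m. c j * h j u)" by presburger
  moreover have "\<forall>j<n+m. h j \<in> A" using n m by (auto simp: h_def)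
  ultimately show ?thesis
    unfolding spanK_def by (intro CollectI exI[of _ "n+m"] exI[of _ c] exI[of _ h] conjI)
qed

lemma spanK_sum:
  assumes "finite I" "\<And>i. i \<in> I \<Longrightarrow> h i \<in> spanK A"
  shows "(\<lambda>u. \<Sum>i\<in>I. cf i * h i u) \<in> spanK A"
  using assms
proof (induction I rule: finite_induct)
  case empty
  show ?case using spanK_zero by simp
next
  case (insert i I)
  show ?case
    unfolding sum.insert[OF insert(1,2)]
    by (rule spanK_add[OF spanK_smul]) (use insert in auto)
qed

lemma spanK_induct [consumes 1, case_names zero step]:
  assumes "h \<in> spanK A" and "P (\<lambda>u. 0)"
    and step: "\<And>f p s. f \<in> A \<Longrightarrow> p \<in> spanK A \<Longrightarrow> P p \<Longrightarrow> P (\<lambda>u. p u + s * f u)"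
  shows "P h"
proof -
  obtain n :: nat and cf fs where n: "\<forall>j<n. fs j \<in> A" and h: "h = (\<lambda>u. \<Sum>j<n. cf j * fs j u)"
    using assms(1) unfolding spanK_def by blast
  have "k \<le> n \<Longrightarrow> P (\<lambda>u. \<Sum>j<k. cf j * fs j u) \<and> (\<lambda>u. \<Sum>j<k. cf j * fs j u) \<in> spanK A" for k
  proof (induction k)
    case 0
    then show ?case using assms(2) spanK_zero by simp
  next
    case (Suc k)
    then have "fs k \<in> A" using n by simp
    then show ?case using Suc step[of "fs k" _ "cf k"]
      spanK_add[OF _ spanK_smul[OF spanK_base]] by fastforce
  qed
  then show ?thesis using h by auto
qed

lemma spanK_mono:
  assumes "A \<subseteq> spanK B" shows "spanK A \<subseteq> spanK B"
proof
  fix h assume "h \<in> spanK A"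
  then show "h \<in> spanK B"
  proof (induction rule: spanK_induct)
    case zero
    show ?case by (rule spanK_zero)
  next
    case (step f p s)
    show ?case by (rule spanK_add[OF step(3) spanK_smul]) (use step(1) assms in blast)
  qed
qed

text \<open>Subtracting the rank-one function \<open>h(\<cdot>,w0) h(u0,\<cdot>) / h(u0,w0)\<close> kills the row \<open>u0\<close>.\<close>

lemma ptens_span:
  fixes h :: "'a list \<times> 'a list \<Rightarrow> 'k::field"
  assumes "finite {u. \<exists>w. h (u, w) \<noteq> 0}"
    and "\<And>u. (\<lambda>w. h (u, w)) \<in> spanK C" and "\<And>w. (\<lambda>u. h (u, w)) \<in> spanK B"
  shows "h \<in> spanK {ptens x y | x y. x \<in> spanK B \<and> y \<in> spanK C}"
  using assms
proof (induction "card {u. \<exists>w. h (u, w) \<noteq> 0}" arbitrary: h rule: less_induct)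
  case (less h)
  show ?case
  proof (cases "\<exists>u w. h (u, w) \<noteq> 0")
    case False
    then have "h = (\<lambda>u. 0)" by auto
    then show ?thesis by (simp only: spanK_zero)
  next
    case True
    then obtain u0 w0 where nz: "h (u0, w0) \<noteq> 0" by blast
    define x where "x = (\<lambda>u. h (u, w0))"
    define y where "y = (\<lambda>w. h (u0, w))"
    define h' where "h' = (\<lambda>z. h z + (- 1 / h (u0, w0)) * ptens x y z)"
    \<comment> \<open>The same correction is read in two ways: for fixed \<open>u\<close> it adds a
      multiple of the row \<open>u0\<close>, for fixed \<open>w\<close> a multiple of the column
      \<open>w0\<close>. Hence rows stay in \<open>spanK C\<close> and columns in
      \<open>spanK B\<close>.\<close>
    have h': "h' (u, w) = h (u, w) + (- h (u, w0) / h (u0, w0)) * h (u0, w)" for u w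
      by (simp add: h'_def ptens_def x_def y_def)
    have h'2: "h' (u, w) = h (u, w) + (- h (u0, w) / h (u0, w0)) * h (u, w0)" for u w
      by (simp add: h' )
    have sub: "{u. \<exists>w. h' (u, w) \<noteq> 0} \<subseteq> {u. \<exists>w. h (u, w) \<noteq> 0} - {u0}"
    proof
      fix u assume "u \<in> {u. \<exists>w. h' (u, w) \<noteq> 0}"
      then obtain w where w: "h' (u, w) \<noteq> 0" by blast
      then have "u \<noteq> u0" using nz by (auto simp: h')
      moreover have "h (u, w) \<noteq> 0 \<or> h (u, w0) \<noteq> 0" using w by (auto simp: h')
      ultimately show "u \<in> {u. \<exists>w. h (u, w) \<noteq> 0} - {u0}" by blast
    qed
    have card: "card {u. \<exists>w. h' (u, w) \<noteq> 0} < card {u. \<exists>w. h (u, w) \<noteq> 0}"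
    proof (rule psubset_card_mono[OF less.prems(1)])
      have "u0 \<in> {u. \<exists>w. h (u, w) \<noteq> 0}" using nz by blast
      then show "{u. \<exists>w. h' (u, w) \<noteq> 0} \<subset> {u. \<exists>w. h (u, w) \<noteq> 0}" using sub by blast
    qed
    have fin: "finite {u. \<exists>w. h' (u, w) \<noteq> 0}"
      using sub less.prems(1) by (meson finite_Diff finite_subset)
    have "h' \<in> spanK {ptens x y | x y. x \<in> spanK B \<and> y \<in> spanK C}"
    proof (rule less.hyps[OF card fin])
      show "(\<lambda>w. h' (u, w)) \<in> spanK C" for u
        unfolding h' by (intro spanK_add spanK_smul less.prems)
      show "(\<lambda>u. h' (u, w)) \<in> spanK B" for w
        unfolding h'2 by (intro spanK_add spanK_smul less.prems)
    qed
    moreover have "ptens x y \<in> spanK {ptens x y | x y. x \<in> spanK B \<and> y \<in> spanK C}"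
      using less.prems(2,3) by (intro spanK_base) (auto simp: x_def y_def)
    ultimately have "(\<lambda>z. h' z + (1 / h (u0, w0)) * ptens x y z)
        \<in> spanK {ptens x y | x y. x \<in> spanK B \<and> y \<in> spanK C}"
      by (intro spanK_add spanK_smul)
    moreover have "(\<lambda>z. h' z + (1 / h (u0, w0)) * ptens x y z) = h"
      by (simp add: h'_def)
    ultimately show ?thesis by simp
  qed
qed

section \<open>Linear extension\<close>

lemma lin_superset:
  assumes "finite A" "{w. f w \<noteq> 0} \<subseteq> A"
  shows "lin F f u = (\<Sum>w\<in>A. f w * F w u)"
  unfolding lin_def using assms by (intro sum.mono_neutral_left) auto

lemma lin_smul_delta: "lin F (\<lambda>u. s * delta w u) = (\<lambda>u. s * F w u)"
proof
  fix u
  have "lin F (\<lambda>u. s * delta w u) u = (\<Sum>v\<in>{w}. (s * delta w v) * F v u)"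
    by (rule lin_superset) (auto simp: delta_def split: if_splits)
  then show "lin F (\<lambda>u. s * delta w u) u = s * F w u" by (simp add: delta_def)
qed

lemma lin_delta: "lin F (delta w) = F w"
  using lin_smul_delta[of F 1 w] by simp

lemma lin_smul:
  assumes "finite {w. f w \<noteq> 0}"
  shows "lin F (\<lambda>u. s * f u) = (\<lambda>u. s * lin F f u)"
proof
  fix u
  have "lin F (\<lambda>u. s * f u) u = (\<Sum>w\<in>{w. f w \<noteq> 0}. (s * f w) * F w u)"
    by (rule lin_superset[OF assms]) auto
  then show "lin F (\<lambda>u. s * f u) u = s * lin F f u"
    by (simp add: lin_def sum_distrib_left mult.assoc)
qed

lemma lin_add:
  assumes "finite {w. f w \<noteq> 0}" "finite {w. g w \<noteq> 0}"
  shows "lin F (\<lambda>u. f u + g u) = (\<lambda>u. lin F f u + lin F g u)"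
proof
  fix u
  let ?A = "{w. f w \<noteq> 0} \<union> {w. g w \<noteq> 0}"
  have A: "finite ?A" using assms by simp
  have "lin F (\<lambda>u. f u + g u) u = (\<Sum>w\<in>?A. (f w + g w) * F w u)"
    by (rule lin_superset[OF A]) auto
  also have "\<dots> = lin F f u + lin F g u"
    by (simp add: lin_superset[OF A, of f] lin_superset[OF A, of g] distrib_right sum.distrib)
  finally show "lin F (\<lambda>u. f u + g u) u = lin F f u + lin F g u" .
qed

lemma fins_finite: "fins X f \<Longrightarrow> finite {u. f u \<noteq> 0}"
  by (simp add: fins_def)

lemma fins_zero: "fins X (\<lambda>u. 0)"
  by (simp add: fins_def)

lemma fins_delta: "set w \<subseteq> X \<Longrightarrow> fins X (delta w)"
  by (auto simp: fins_def delta_def split: if_splits)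

lemma fins_smul:
  fixes f :: "'a list \<Rightarrow> 'k::comm_ring_1"
  assumes "fins X f" shows "fins X (\<lambda>u. s * f u)"
proof -
  have "{u. s * f u \<noteq> 0} \<subseteq> {u. f u \<noteq> 0}" by auto
  then show ?thesis
    using assms unfolding fins_def by (blast intro: finite_subset)
qed

lemma fins_add:
  fixes f g :: "'a list \<Rightarrow> 'k::comm_ring_1"
  assumes "fins X f" "fins X g" shows "fins X (\<lambda>u. f u + g u)"
proof -
  have "{u. f u + g u \<noteq> 0} \<subseteq> {u. f u \<noteq> 0} \<union> {u. g u \<noteq> 0}" by auto
  then show ?thesis
    using assms unfolding fins_def by (blast intro: finite_subset)
qed

lemma fins_sum:
  assumes "finite I" "\<And>i. i \<in> I \<Longrightarrow> fins X (h i)"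
  shows "fins X (\<lambda>u. \<Sum>i\<in>I. cf i * h i u :: 'k::comm_ring_1)"
  using assms
proof (induction I rule: finite_induct)
  case empty
  show ?case using fins_zero by simp
next
  case (insert i I)
  show ?case
    unfolding sum.insert[OF insert(1,2)]
    by (rule fins_add[OF fins_smul]) (use insert in auto)
qed

lemma lin_sum:
  assumes "finite I" "\<And>i. i \<in> I \<Longrightarrow> finite {w. h i w \<noteq> 0}"
  shows "lin F (\<lambda>u. \<Sum>i\<in>I. cf i * h i u) = (\<lambda>u. \<Sum>i\<in>I. cf i * lin F (h i) u)"
  using assms
proof (induction I rule: finite_induct)
  case empty
  then show ?case by (simp add: lin_def)
next
  case (insert i I)
  have fi: "finite {w. (\<Sum>i\<in>I. cf i * h i w) \<noteq> 0}"
    using fins_sum[of I UNIV h cf] insert by (auto simp: fins_def)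
  have fh: "finite {w. cf i * h i w \<noteq> 0}"
    using insert.prems[of i] by (auto elim!: finite_subset[rotated])
  show ?case
    using insert fi fh by (simp add: lin_add lin_smul)
qed

lemma delta_decomp:
  fixes f :: "'a list \<Rightarrow> 'k::comm_ring_1"
  assumes "finite {w. f w \<noteq> 0}"
  shows "f = (\<lambda>u. \<Sum>w\<in>{w. f w \<noteq> 0}. f w * delta w u)"
proof
  fix u
  have "(\<Sum>w\<in>{w. f w \<noteq> 0}. f w * delta w u) = (\<Sum>w\<in>{w. f w \<noteq> 0}. if w = u then f u else 0)"
    by (rule sum.cong) (auto simp: delta_def)
  also have "\<dots> = f u" using assms by (simp add: sum.delta')
  finally show "f u = (\<Sum>w\<in>{w. f w \<noteq> 0}. f w * delta w u)" by simp
qed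

text \<open>Cut positions of \<open>u\<close> correspond to pairs of words with concatenation
  \<open>u\<close>. Extending the range to all pairs in the supports adds only zeros and makes the
  index set independent of \<open>u\<close>, as bilinear arguments require.\<close>

lemma tens_decomp:
  fixes f g :: "'a list \<Rightarrow> 'k::comm_ring_1"
  assumes F: "finite {w. f w \<noteq> 0}" and G: "finite {w. g w \<noteq> 0}"
  shows "tens f g = (\<lambda>u. \<Sum>(v,w)\<in>{w. f w \<noteq> 0} \<times> {w. g w \<noteq> 0}. f v * g w * delta (v @ w) u)"
proof
  fix u :: "'a list"
  let ?P = "{w. f w \<noteq> 0} \<times> {w. g w \<noteq> 0}"
  let ?s = "\<lambda>i. (take i u, drop i u)"
  have inj: "inj_on ?s {..length u}"
    by (rule inj_on_inverseI[of _ "\<lambda>(x, y). length x"]) simp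
  have img: "?s ` {..length u} = {(v, w). v @ w = u}"
  proof (intro equalityI subsetI)
    fix z assume "z \<in> {(v, w). v @ w = u}"
    then obtain v w where "z = (v, w)" "v @ w = u" by auto
    then have "z = ?s (length v)" "length v \<le> length u" by auto
    then show "z \<in> ?s ` {..length u}" by blast
  qed auto
  have "tens f g u = (\<Sum>(v, w)\<in>{(v, w). v @ w = u}. f v * g w)"
    unfolding tens_def img[symmetric] by (subst sum.reindex[OF inj]) simp
  also have "\<dots> = (\<Sum>(v, w)\<in>{(v, w). v @ w = u}. f v * g w * delta (v @ w) u)"
    by (rule sum.cong) (auto simp: delta_def)
  also have "\<dots> = (\<Sum>(v, w)\<in>?P. f v * g w * delta (v @ w) u)"
  proof (rule sum.mono_neutral_cong)
    show "finite {(v, w). v @ w = u}" unfolding img[symmetric] by simp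
    show "finite ?P" using F G by simp
  qed (auto simp: delta_def split: if_splits)
  finally show "tens f g u = (\<Sum>(v,w)\<in>?P. f v * g w * delta (v @ w) u)" .
qed

lemma fins_tens:
  fixes f g :: "'a list \<Rightarrow> 'k::comm_ring_1"
  assumes "fins X f" "fins X g" shows "fins X (tens f g)"
proof -
  have "fins X (\<lambda>u. \<Sum>z\<in>{w. f w \<noteq> 0} \<times> {w. g w \<noteq> 0}. (f (fst z) * g (snd z)) * delta (fst z @ snd z) u)"
  proof (rule fins_sum)
    show "finite ({w. f w \<noteq> 0} \<times> {w. g w \<noteq> 0})" using assms by (simp add: fins_def)
    fix z assume "z \<in> {w. f w \<noteq> 0} \<times> {w. g w \<noteq> 0}"
    then have "f (fst z) \<noteq> 0" "g (snd z) \<noteq> 0" by auto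
    then have "set (fst z @ snd z) \<subseteq> X" using assms unfolding fins_def by simp
    then show "fins X (delta (fst z @ snd z) :: 'a list \<Rightarrow> 'k)" by (rule fins_delta)
  qed
  then show ?thesis using assms by (simp add: tens_decomp fins_finite case_prod_unfold)
qed

lemma fins_tensl: "(\<And>p. p \<in> set ws \<Longrightarrow> fins X p) \<Longrightarrow> fins X (tensl ws)"
  unfolding tensl_def by (induction ws) (simp_all add: fins_delta fins_tens)

lemma tens_delta_nil: "tens f (delta []) = f"
proof
  fix u
  have "tens f (delta []) u = (\<Sum>i\<le>length u. if i = length u then f u else 0)"
    unfolding tens_def by (rule sum.cong) (auto simp: delta_def)
  then show "tens f (delta []) u = f u" by simp
qed

lemma tensl_singleton: "tensl [f] = f"
  by (simp add: tensl_def tens_delta_nil)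

lemma tensl_Cons: "tensl (f # ws) = tens f (tensl ws)"
  by (simp add: tensl_def)

lemma tensl_nonzero:
  assumes "tensl ws u \<noteq> 0"
    and "\<And>h v. h \<in> set ws \<Longrightarrow> h v \<noteq> 0 \<Longrightarrow> set v \<subseteq> S"
  shows "set u \<subseteq> S"
  using assms
proof (induction ws arbitrary: u)
  case Nil
  then show ?case by (auto simp: tensl_def delta_def split: if_splits)
next
  case (Cons h ws)
  then obtain i where "h (take i u) * tensl ws (drop i u) \<noteq> 0"
    unfolding tensl_Cons tens_def by (meson sum.not_neutral_contains_not_neutral)
  then have "h (take i u) \<noteq> 0" "tensl ws (drop i u) \<noteq> 0" by auto
  then have "set (take i u) \<subseteq> S" "set (drop i u) \<subseteq> S"
    using Cons.prems(2)[of h] Cons.IH[of "drop i u"] Cons.prems(2) by auto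
  then show ?case by (metis append_take_drop_id set_append Un_least)
qed

section \<open>The quantum shuffle algebra of a rack with a two-cocycle\<close>

text \<open>The coproduct is deconcatenation, so splitting off a last letter \<open>y\<close>
  extracts the component whose right tensor factor is \<open>v_y\<close>; this is a right skew
  derivation, and \<open>lder\<close> is its left counterpart.\<close>

definition rder :: "'a \<Rightarrow> ('a list \<Rightarrow> 'k) \<Rightarrow> 'a list \<Rightarrow> 'k" where
  "rder y p = (\<lambda>u. p (u @ [y]))"

definition lder :: "'a \<Rightarrow> ('a list \<Rightarrow> 'k) \<Rightarrow> 'a list \<Rightarrow> 'k" where
  "lder y p = (\<lambda>u. p (y # u))"

text \<open>The condition on letters in \<open>fins\<close> without finiteness: \<open>act\<close>
  discards words outside \<open>X\<close>, so the algebra laws of \<open>qsh\<close> are proved for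
  functions living on words over \<open>X\<close>, while inductions on the evaluated word work for
  arbitrary supports.\<close>

definition supX :: "'a set \<Rightarrow> ('a list \<Rightarrow> 'k::zero) \<Rightarrow> bool" where
  "supX X p \<longleftrightarrow> (\<forall>u. p u \<noteq> 0 \<longrightarrow> set u \<subseteq> X)"

lemma supX_delta: "set w \<subseteq> X \<Longrightarrow> supX X (delta w)"
  by (auto simp: supX_def delta_def split: if_splits)

lemma supX_smul: "supX X p \<Longrightarrow> supX X (\<lambda>u. s * p u :: 'k::comm_ring_1)"
  unfolding supX_def by (metis mult_zero_right)

lemma supX_rder: "supX X p \<Longrightarrow> supX X (rder y p)"
  unfolding supX_def rder_def by fastforce

lemma supX_lder: "supX X p \<Longrightarrow> supX X (lder y p)"
  unfolding supX_def lder_def by fastforce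

lemma rder_notin: "supX X p \<Longrightarrow> y \<notin> X \<Longrightarrow> rder y p = (\<lambda>u. 0)"
  unfolding supX_def rder_def by fastforce

lemma lder_notin: "supX X p \<Longrightarrow> y \<notin> X \<Longrightarrow> lder y p = (\<lambda>u. 0)"
  unfolding supX_def lder_def by fastforce

lemma rder_add: "rder y (\<lambda>u. p u + r u) = (\<lambda>u. rder y p u + rder y r u)"
  by (simp add: rder_def)

lemma rder_smul: "rder y (\<lambda>u. s * p u) = (\<lambda>u. s * rder y p u)"
  by (simp add: rder_def)

lemma rder_zero: "rder y (\<lambda>u. 0) = (\<lambda>u. 0)"
  by (simp add: rder_def)

lemma lder_add: "lder y (\<lambda>u. p u + r u) = (\<lambda>u. lder y p u + lder y r u)"
  by (simp add: lder_def)

lemma lder_smul: "lder y (\<lambda>u. s * p u) = (\<lambda>u. s * lder y p u)"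
  by (simp add: lder_def)

lemma rder_delta_nil: "rder y (delta []) = (\<lambda>u. 0)"
  by (simp add: rder_def delta_def)

lemma rder_delta_snoc:
  "rder y (delta (w @ [z])) = (\<lambda>u. (if y = z then 1 else 0) * delta w u :: 'k::comm_ring_1)"
  by (auto simp: rder_def delta_def)

lemma rder_delta1:
  "rder y (delta [z]) = (\<lambda>u. (if y = z then 1 else 0) * delta [] u :: 'k::comm_ring_1)"
  using rder_delta_snoc[of y "[]" z] by simp

lemma rder_lder: "rder y (lder x p) = lder x (rder y p)"
  by (simp add: rder_def lder_def)

locale rack_cocycle =
  fixes X :: "'a set" and rk :: "'a \<Rightarrow> 'a \<Rightarrow> 'a" and q :: "'a \<Rightarrow> 'a \<Rightarrow> 'k::field"
  assumes rk_closed: "x \<in> X \<Longrightarrow> y \<in> X \<Longrightarrow> rk x y \<in> X"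
    and rk_dist: "x \<in> X \<Longrightarrow> y \<in> X \<Longrightarrow> z \<in> X \<Longrightarrow> rk x (rk y z) = rk (rk x y) (rk x z)"
    and rk_inj: "x \<in> X \<Longrightarrow> y \<in> X \<Longrightarrow> z \<in> X \<Longrightarrow> rk x y = rk x z \<Longrightarrow> y = z"
    and rk_surj: "x \<in> X \<Longrightarrow> z \<in> X \<Longrightarrow> \<exists>y\<in>X. rk x y = z"
    and cocyc: "x \<in> X \<Longrightarrow> y \<in> X \<Longrightarrow> z \<in> X \<Longrightarrow> q (rk x y) (rk x z) * q x z = q x (rk y z) * q y z"
begin

definition ri :: "'a \<Rightarrow> 'a \<Rightarrow> 'a" where
  "ri x = inv_into X (rk x)"

definition qw :: "'a \<Rightarrow> 'a list \<Rightarrow> 'k" where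
  "qw x w = prod_list (map (q x) w)"

text \<open>The action of \<open>g_x\<close> on the tensor algebra, written on coefficients: the
  coefficient at \<open>u\<close> comes from the unique preimage of \<open>u\<close>. Words leaving
  \<open>X\<close> get 0 because \<open>ri\<close> has no meaning there.\<close>

definition act :: "'a \<Rightarrow> ('a list \<Rightarrow> 'k) \<Rightarrow> 'a list \<Rightarrow> 'k" where
  "act x p u = (if set u \<subseteq> X then qw x (map (ri x) u) * p (map (ri x) u) else 0)"

lemma rk_inj_on: "x \<in> X \<Longrightarrow> inj_on (rk x) X"
  using rk_inj by (auto intro!: inj_onI)

lemma ri_rk: "x \<in> X \<Longrightarrow> y \<in> X \<Longrightarrow> ri x (rk x y) = y"
  unfolding ri_def by (rule inv_into_f_f[OF rk_inj_on])

lemma rk_image: "x \<in> X \<Longrightarrow> rk x ` X = X"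
  using rk_closed rk_surj by blast

lemma rk_ri: "x \<in> X \<Longrightarrow> y \<in> X \<Longrightarrow> rk x (ri x y) = y"
  unfolding ri_def by (rule f_inv_into_f) (simp add: rk_image)

lemma ri_closed: "x \<in> X \<Longrightarrow> y \<in> X \<Longrightarrow> ri x y \<in> X"
  unfolding ri_def using inv_into_into[of y "rk x" X] by (simp add: rk_image)

lemma map_rk_closed: "x \<in> X \<Longrightarrow> set w \<subseteq> X \<Longrightarrow> set (map (rk x) w) \<subseteq> X"
  using rk_closed by auto

lemma map_ri_rk: "x \<in> X \<Longrightarrow> set w \<subseteq> X \<Longrightarrow> map (ri x) (map (rk x) w) = w"
  by (induction w) (auto simp: ri_rk)

lemma map_rk_ex: "x \<in> X \<Longrightarrow> set u \<subseteq> X \<Longrightarrow> \<exists>v. set v \<subseteq> X \<and> u = map (rk x) v"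
  by (rule exI[of _ "map (ri x) u"]) (auto simp: rk_ri ri_closed comp_def subset_iff intro!: nth_equalityI)

lemma act_map: "x \<in> X \<Longrightarrow> set v \<subseteq> X \<Longrightarrow> act x p (map (rk x) v) = qw x v * p v"
  unfolding act_def by (simp only: map_ri_rk map_rk_closed if_True)

lemma act_outside: "\<not> set u \<subseteq> X \<Longrightarrow> act x p u = 0"
  by (simp add: act_def)

lemma act_eqI:
  assumes "x \<in> X" "supX X r" "\<And>v. set v \<subseteq> X \<Longrightarrow> r (map (rk x) v) = qw x v * p v"
  shows "act x p = r"
proof
  fix u show "act x p u = r u"
  proof (cases "set u \<subseteq> X")
    case True
    then show ?thesis using map_rk_ex[OF assms(1) True] assms act_map by auto
  next
    case False
    then show ?thesis using assms(2) by (auto simp: act_outside supX_def)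
  qed
qed

lemma supX_act: "supX X (act x p)"
  by (simp add: supX_def act_def)

lemma act_add: "act x (\<lambda>u. p u + r u) = (\<lambda>u. act x p u + act x r u)"
  by (auto simp: act_def algebra_simps)

lemma act_smul: "act x (\<lambda>u. s * p u) = (\<lambda>u. s * act x p u)"
  by (auto simp: act_def)

lemma act_zero: "act x (\<lambda>u. 0) = (\<lambda>u. 0)"
  by (auto simp: act_def)

lemma act_nil: "act x p [] = p []"
  by (simp add: act_def qw_def)

lemma act_delta:
  assumes "x \<in> X" "set w \<subseteq> X"
  shows "act x (delta w) = (\<lambda>u. qw x w * delta (map (rk x) w) u)"
proof (rule act_eqI[OF assms(1)])
  show "supX X (\<lambda>u. qw x w * delta (map (rk x) w) u)"
    by (intro supX_smul supX_delta map_rk_closed assms)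
  fix v assume v: "set v \<subseteq> X"
  have "map (rk x) v = map (rk x) w \<longleftrightarrow> v = w"
    using map_ri_rk[OF assms] map_ri_rk[OF assms(1) v] by metis
  then show "qw x w * delta (map (rk x) w) (map (rk x) v) = qw x v * delta w v"
    by (auto simp: delta_def)
qed

lemma act_delta_nil: "act x (delta []) = delta []"
  by (auto simp: act_def delta_def qw_def)

lemma rder_act:
  assumes "x \<in> X" "z \<in> X"
  shows "rder (rk x z) (act x p) = (\<lambda>u. q x z * act x (rder z p) u)"
  using assms by (auto simp: rder_def act_def ri_rk rk_closed qw_def)

lemma lder_act:
  assumes "x \<in> X" "z \<in> X"
  shows "lder (rk x z) (act x p) = (\<lambda>u. q x z * act x (lder z p) u)"
  using assms by (auto simp: lder_def act_def ri_rk rk_closed qw_def)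

text \<open>This is the defining relation of the enveloping group. On permutations it is
  self-distributivity, on scalars it is the cocycle condition multiplied over the letters of the
  word.\<close>

lemma act_act:
  assumes "x \<in> X" "y \<in> X"
  shows "act x (act y p) = act (rk x y) (act x p)"
proof (rule act_eqI[OF assms(1) supX_act])
  fix v assume v: "set v \<subseteq> X"
  have xy: "rk x y \<in> X" using assms rk_closed by simp
  obtain w where w: "set w \<subseteq> X" "v = map (rk y) w" using map_rk_ex[OF assms(2) v] by blast
  have eq: "map (rk x) v = map (rk (rk x y)) (map (rk x) w)"
    using w assms by (auto simp: rk_dist)
  have "act (rk x y) (act x p) (map (rk x) v) = qw (rk x y) (map (rk x) w) * (qw x w * p w)"
    unfolding eq by (simp only: act_map[OF xy map_rk_closed[OF assms(1) w(1)]] act_map[OF assms(1) w(1)])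
  also have "\<dots> = qw x v * (qw y w * p w)"
  proof -
    have "qw (rk x y) (map (rk x) w) * qw x w = qw x (map (rk y) w) * qw y w"
      using w(1)
    proof (induction w)
      case (Cons z w)
      have "qw (rk x y) (map (rk x) (z # w)) * qw x (z # w)
          = (q (rk x y) (rk x z) * q x z) * (qw (rk x y) (map (rk x) w) * qw x w)"
        by (simp add: qw_def)
      also have "\<dots> = (q x (rk y z) * q y z) * (qw x (map (rk y) w) * qw y w)"
        using Cons assms by (simp add: cocyc)
      finally show ?case by (simp add: qw_def)
    qed (simp add: qw_def)
    then show ?thesis unfolding w(2) by (simp add: mult.assoc[symmetric])
  qed
  also have "qw y w * p w = act y p v" unfolding w(2) by (simp add: act_map[OF assms(2) w(1)])
  finally show "act (rk x y) (act x p) (map (rk x) v) = qw x v * act y p v" .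
qed

text \<open>The product of the quantum shuffle algebra, defined through the Leibniz rule of the right skew
  derivations; the word argument is reversed.\<close>

primrec qshr :: "'a list \<Rightarrow> ('a list \<Rightarrow> 'k) \<Rightarrow> ('a list \<Rightarrow> 'k) \<Rightarrow> 'k" where
  "qshr [] p r = p [] * r []"
| "qshr (y # v) p r = qshr v p (rder y r) + qshr v (rder y p) (act y r)"

definition qsh :: "('a list \<Rightarrow> 'k) \<Rightarrow> ('a list \<Rightarrow> 'k) \<Rightarrow> 'a list \<Rightarrow> 'k" where
  "qsh p r u = qshr (rev u) p r"

lemma qsh_nil: "qsh p r [] = p [] * r []"
  by (simp add: qsh_def)

lemma qsh_snoc: "qsh p r (u @ [y]) = qsh p (rder y r) u + qsh (rder y p) (act y r) u"
  by (simp add: qsh_def)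

lemma rder_qsh: "rder y (qsh p r) = (\<lambda>u. qsh p (rder y r) u + qsh (rder y p) (act y r) u)"
  unfolding rder_def[of y "qsh p r"] by (simp add: qsh_snoc)

lemma qsh_zero_left: "qsh (\<lambda>u. 0) r = (\<lambda>u. 0)"
proof
  fix u show "qsh (\<lambda>u. 0) r u = 0"
    by (induction u arbitrary: r rule: rev_induct) (simp_all add: qsh_nil qsh_snoc rder_zero)
qed

lemma qsh_zero_right: "qsh p (\<lambda>u. 0) = (\<lambda>u. 0)"
proof
  fix u show "qsh p (\<lambda>u. 0) u = 0"
    by (induction u arbitrary: p rule: rev_induct) (simp_all add: qsh_nil qsh_snoc rder_zero act_zero)
qed

lemma qsh_add_left: "qsh (\<lambda>u. p u + p' u) r = (\<lambda>u. qsh p r u + qsh p' r u)"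
proof
  fix u show "qsh (\<lambda>u. p u + p' u) r u = qsh p r u + qsh p' r u"
    by (induction u arbitrary: p p' r rule: rev_induct)
      (simp_all add: qsh_nil qsh_snoc rder_add distrib_right)
qed

lemma qsh_add_right: "qsh p (\<lambda>u. r u + r' u) = (\<lambda>u. qsh p r u + qsh p r' u)"
proof
  fix u show "qsh p (\<lambda>u. r u + r' u) u = qsh p r u + qsh p r' u"
    by (induction u arbitrary: p r r' rule: rev_induct)
      (simp_all add: qsh_nil qsh_snoc rder_add act_add distrib_left)
qed

lemma qsh_smul_left: "qsh (\<lambda>u. s * p u) r = (\<lambda>u. s * qsh p r u)"
proof
  fix u show "qsh (\<lambda>u. s * p u) r u = s * qsh p r u"
    by (induction u arbitrary: p r rule: rev_induct)
      (simp_all add: qsh_nil qsh_snoc rder_smul distrib_left)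
qed

lemma qsh_smul_right: "qsh p (\<lambda>u. s * r u) = (\<lambda>u. s * qsh p r u)"
proof
  fix u show "qsh p (\<lambda>u. s * r u) u = s * qsh p r u"
    by (induction u arbitrary: p r rule: rev_induct)
      (simp_all add: qsh_nil qsh_snoc rder_smul act_smul distrib_left)
qed

lemma qsh_sum_left:
  "finite I \<Longrightarrow> qsh (\<lambda>u. \<Sum>i\<in>I. cf i * h i u) r = (\<lambda>u. \<Sum>i\<in>I. cf i * qsh (h i) r u)"
  by (induction I rule: finite_induct) (simp_all add: qsh_zero_left qsh_add_left qsh_smul_left)

lemma qsh_sum_right:
  "finite I \<Longrightarrow> qsh p (\<lambda>u. \<Sum>i\<in>I. cf i * h i u) = (\<lambda>u. \<Sum>i\<in>I. cf i * qsh p (h i) u)"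
  by (induction I rule: finite_induct) (simp_all add: qsh_zero_right qsh_add_right qsh_smul_right)

lemma supX_qsh: "supX X p \<Longrightarrow> supX X r \<Longrightarrow> supX X (qsh p r)"
proof -
  have "supX X p \<Longrightarrow> supX X r \<Longrightarrow> qsh p r u \<noteq> 0 \<Longrightarrow> set u \<subseteq> X" for u
  proof (induction u arbitrary: p r rule: rev_induct)
    case (snoc y u)
    have "y \<in> X"
      using snoc.prems by (cases "y \<in> X") (auto simp: qsh_snoc rder_notin qsh_zero_left qsh_zero_right)
    moreover have "qsh p (rder y r) u \<noteq> 0 \<or> qsh (rder y p) (act y r) u \<noteq> 0"
      using snoc.prems(3) by (auto simp: qsh_snoc)
    then have "set u \<subseteq> X"
      using snoc.IH[OF snoc.prems(1) supX_rder[OF snoc.prems(2)]]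
        snoc.IH[OF supX_rder[OF snoc.prems(1)] supX_act] by blast
    ultimately show ?case by simp
  qed simp
  then show "supX X p \<Longrightarrow> supX X r \<Longrightarrow> supX X (qsh p r)"
    unfolding supX_def[of X "qsh p r"] by blast
qed

text \<open>Each \<open>g_x\<close> acts by an algebra automorphism. The derivation at
  \<open>rk x z\<close> of an image under \<open>act x\<close> is \<open>q x z\<close> times the
  image of the derivation at \<open>z\<close>, and \<open>act_act\<close> reorders the two actions
  in the second Leibniz term.\<close>

lemma act_qsh:
  assumes "x \<in> X" "supX X p" "supX X r"
  shows "act x (qsh p r) = qsh (act x p) (act x r)"
proof
  fix u show "act x (qsh p r) u = qsh (act x p) (act x r) u"
    using assms(2,3)
  proof (induction u arbitrary: p r rule: rev_induct)
    case Nil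
    show ?case by (simp add: act_nil qsh_nil)
  next
    case (snoc y u)
    show ?case
    proof (cases "y \<in> X")
      case False
      then show ?thesis
        using supX_qsh[OF supX_act supX_act, of x p x r] by (force simp: act_outside supX_def)
    next
      case True
      then obtain z where z: "z \<in> X" "y = rk x z" using rk_surj[OF assms(1)] by blast
      have "act x (qsh p r) (u @ [y]) = rder y (act x (qsh p r)) u" by (simp add: rder_def)
      also have "\<dots> = q x z * (act x (qsh p (rder z r)) u + act x (qsh (rder z p) (act z r)) u)"
        unfolding z(2) rder_act[OF assms(1) z(1)] rder_qsh act_add by simp
      also have "\<dots> = q x z * (qsh (act x p) (act x (rder z r)) u
          + qsh (act x (rder z p)) (act x (act z r)) u)"
        using snoc by (simp add: supX_rder supX_act)
      also have "\<dots> = rder y (qsh (act x p) (act x r)) u"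
        unfolding rder_qsh unfolding z(2) rder_act[OF assms(1) z(1)] act_act[OF assms(1) z(1)]
          qsh_smul_left qsh_smul_right by (simp add: distrib_left)
      finally show ?thesis by (simp add: rder_def)
    qed
  qed
qed

text \<open>Taking the right derivation of either bracketing yields three terms, one per factor.
  They agree by induction; in the term that differentiates \<open>p\<close>, the action on the
  product of \<open>r\<close> and \<open>s\<close> splits by \<open>act_qsh\<close>.\<close>

lemma qsh_assoc:
  assumes "supX X p" "supX X r" "supX X s"
  shows "qsh (qsh p r) s = qsh p (qsh r s)"
proof
  fix u show "qsh (qsh p r) s u = qsh p (qsh r s) u"
    using assms
  proof (induction u arbitrary: p r s rule: rev_induct)
    case Nil
    show ?case by (simp add: qsh_nil mult.assoc)
  next
    case (snoc y u)
    show ?case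
    proof (cases "y \<in> X")
      case False
      then show ?thesis
        using snoc.prems
        by (simp add: qsh_snoc rder_notin[where X = X] qsh_zero_left qsh_zero_right supX_qsh)
    next
      case True
      then show ?thesis
        using snoc by (simp add: qsh_snoc rder_qsh qsh_add_left qsh_add_right supX_rder supX_act
            act_qsh supX_qsh)
    qed
  qed
qed

lemma qsh_one_left: "qsh (delta []) r = r"
proof
  fix u show "qsh (delta []) r u = r u"
    by (induction u arbitrary: r rule: rev_induct)
      (simp_all add: qsh_nil qsh_snoc rder_delta_nil qsh_zero_left, simp_all add: delta_def rder_def)
qed

lemma qsh_one_right: "qsh p (delta []) = p"
proof
  fix u show "qsh p (delta []) u = p u"
    by (induction u arbitrary: p rule: rev_induct)
      (simp_all add: qsh_nil qsh_snoc rder_delta_nil qsh_zero_right act_delta_nil,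
        simp_all add: delta_def rder_def)
qed

lemma qsh_letter: "qsh p r [x] = p [] * r [x] + p [x] * r []"
  using qsh_snoc[of p r "[]" x] by (simp add: qsh_nil rder_def act_nil)

lemma rder_qsh_letter:
  "rder y (qsh (delta [x]) r) = (\<lambda>u. qsh (delta [x]) (rder y r) u + (if y = x then 1 else 0) * act x r u)"
  unfolding rder_qsh rder_delta1 qsh_smul_left qsh_one_left by auto

text \<open>Multiplication by one letter inserts it at every position \<open>k\<close>, after
  braiding it past the first \<open>k\<close> letters. This is the bridge to the summands of
  \<open>Tsum\<close>.\<close>

lemma qsh_letter_delta:
  assumes "x \<in> X" "set v \<subseteq> X"
  shows "qsh (delta [x]) (delta v) =
    (\<lambda>u. \<Sum>k\<le>length v. qw x (take k v) * delta (map (rk x) (take k v) @ x # drop k v) u)"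
proof
  fix u
  show "qsh (delta [x]) (delta v) u =
    (\<Sum>k\<le>length v. qw x (take k v) * delta (map (rk x) (take k v) @ x # drop k v) u)"
    using assms(2)
  proof (induction v arbitrary: u rule: rev_induct)
    case Nil
    show ?case by (simp add: qsh_one_right qw_def)
  next
    case (snoc z v)
    let ?d = "\<lambda>v k. qw x (take k v) * delta (map (rk x) (take k v) @ x # drop k v) u"
    show ?case
    proof (cases u rule: rev_cases)
      case Nil
      then show ?thesis by (simp add: qsh_nil delta_def)
    next
      case (snoc u' y)
      have "qsh (delta [x]) (delta (v @ [z])) u = rder y (qsh (delta [x]) (delta (v @ [z]))) u'"
        by (simp add: snoc rder_def)
      also have "\<dots> = (if y = z then 1 else 0) * qsh (delta [x]) (delta v) u'
          + (if y = x then 1 else 0) * (qw x (v @ [z]) * delta (map (rk x) (v @ [z])) u')"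
        unfolding rder_qsh_letter rder_delta_snoc qsh_smul_right
        using act_delta[OF assms(1) snoc.prems] by simp
      \<comment> \<open>Insertions before \<open>z\<close> leave \<open>z\<close> as the last
        letter; the one remaining insertion, after \<open>z\<close>, makes \<open>x\<close> the last
        letter and is treated next.\<close>
      also have "(if y = z then 1 else 0) * qsh (delta [x]) (delta v) u'
          = (\<Sum>k\<le>length v. ?d (v @ [z]) k)"
        using snoc.IH[of u'] snoc.prems
        by (auto simp: snoc delta_def sum_distrib_left intro!: sum.cong)
      also have "(if y = x then 1 else 0) * (qw x (v @ [z]) * delta (map (rk x) (v @ [z])) u')
          = ?d (v @ [z]) (Suc (length v))"
        by (simp add: snoc delta_def)
      finally show ?thesis by simp
    qed
  qed
qed

end

section \<open>The quantum symmetrizer as an iterated shuffle product\<close>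

lemma braidw_at:
  "braidw rk q (Suc (length l)) (l @ x # y # r) = (\<lambda>u. q x y * delta (l @ rk x y # x # r) u)"
  by (auto simp: braidw_def nth_append list_update_append)

lemma prep_decomp:
  fixes p :: "'a list \<Rightarrow> 'k::comm_ring_1"
  assumes "finite {v. p v \<noteq> 0}"
  shows "prep x p = (\<lambda>u. \<Sum>v\<in>{v. p v \<noteq> 0}. p v * delta (x # v) u)"
proof
  fix u
  show "prep x p u = (\<Sum>v\<in>{v. p v \<noteq> 0}. p v * delta (x # v) u)"
  proof (cases "u \<noteq> [] \<and> hd u = x")
    case True
    then obtain w where w: "u = x # w" by (cases u) auto
    have "(\<Sum>v\<in>{v. p v \<noteq> 0}. p v * delta (x # v) u) = (\<Sum>v\<in>{v. p v \<noteq> 0}. p v * delta v w)"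
      by (rule sum.cong) (auto simp: w delta_def)
    also have "\<dots> = p w" using delta_decomp[OF assms] by metis
    finally show ?thesis by (simp add: w prep_def)
  next
    case False
    then have "delta (x # v) u = (0::'k)" for v by (auto simp: delta_def)
    then have "(\<Sum>v\<in>{v. p v \<noteq> 0}. p v * delta (x # v) u) = 0" by simp
    moreover have "prep x p u = 0" using False unfolding prep_def by (rule if_not_P)
    ultimately show ?thesis by simp
  qed
qed

lemma finite_smul_delta: "finite {u. s * delta w u \<noteq> (0::'k::comm_ring_1)}"
  by (rule finite_subset[of _ "{w}"]) (auto simp: delta_def split: if_splits)

context rack_cocycle
begin

abbreviation om :: "'a list \<Rightarrow> 'a list \<Rightarrow> 'k" where
  "om \<equiv> omegaw rk q"

abbreviation insw :: "'a \<Rightarrow> nat \<Rightarrow> 'a list \<Rightarrow> 'a list" where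
  "insw x k v \<equiv> map (rk x) (take k v) @ x # drop k v"

text \<open>The crossings carry the leading \<open>x\<close> past \<open>k\<close> letters. The
  bound on \<open>k\<close> keeps every crossing inside the word, where \<open>braidw\<close> does
  not take its default value 0; finite sums are used because \<open>lin\<close> is additive on
  finite supports.\<close>

lemma Lk_sum_delta:
  assumes "finite I" "\<And>i. i \<in> I \<Longrightarrow> k \<le> length (h i)"
  shows "Lk rk q k (\<lambda>u. \<Sum>i\<in>I. cf i * delta (x # h i) u)
    = (\<lambda>u. \<Sum>i\<in>I. cf i * (qw x (take k (h i)) * delta (insw x k (h i)) u))"
  using assms(2)
proof (induction k)
  case 0
  show ?case by (simp add: qw_def)
next
  case (Suc k)
  have step: "cmap rk q (Suc k) (\<lambda>u. qw x (take k v) * delta (insw x k v) u)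
      = (\<lambda>u. qw x (take (Suc k) v) * delta (insw x (Suc k) v) u)" if "Suc k \<le> length v" for v
  proof -
    have d: "drop k v = v ! k # drop (Suc k) v" using that by (simp add: Cons_nth_drop_Suc)
    have t: "take (Suc k) v = take k v @ [v ! k]" using that by (simp add: take_Suc_conv_app_nth)
    have "braidw rk q (Suc k) (insw x k v)
        = (\<lambda>u. q x (v ! k) * delta (map (rk x) (take k v) @ rk x (v ! k) # x # drop (Suc k) v) u)"
      using braidw_at[of rk q "map (rk x) (take k v)" x "v ! k" "drop (Suc k) v"] that
      unfolding d by simp
    then show ?thesis
      unfolding cmap_def lin_smul_delta by (simp add: t qw_def mult.assoc)
  qed
  have IH: "Lk rk q k (\<lambda>u. \<Sum>i\<in>I. cf i * delta (x # h i) u)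
      = (\<lambda>u. \<Sum>i\<in>I. cf i * (qw x (take k (h i)) * delta (insw x k (h i)) u))"
    by (rule Suc.IH) (rule Suc_leD[OF Suc.prems])
  have "Lk rk q (Suc k) (\<lambda>u. \<Sum>i\<in>I. cf i * delta (x # h i) u)
      = cmap rk q (Suc k) (\<lambda>u. \<Sum>i\<in>I. cf i * (qw x (take k (h i)) * delta (insw x k (h i)) u))"
    unfolding Lk.simps(2) IH ..
  also have "\<dots> = (\<lambda>u. \<Sum>i\<in>I. cf i *
      cmap rk q (Suc k) (\<lambda>u. qw x (take k (h i)) * delta (insw x k (h i)) u) u)"
    unfolding cmap_def
    by (rule lin_sum[OF assms(1), where h = "\<lambda>i u. qw x (take k (h i)) * delta (insw x k (h i)) u"])
      (rule finite_smul_delta)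
  also have "\<dots> = (\<lambda>u. \<Sum>i\<in>I. cf i * (qw x (take (Suc k) (h i)) * delta (insw x (Suc k) (h i)) u))"
  proof (intro ext sum.cong refl)
    fix u i assume "i \<in> I"
    show "cf i * cmap rk q (Suc k) (\<lambda>u. qw x (take k (h i)) * delta (insw x k (h i)) u) u
      = cf i * (qw x (take (Suc k) (h i)) * delta (insw x (Suc k) (h i)) u)"
      unfolding step[OF Suc.prems[OF \<open>i \<in> I\<close>]] ..
  qed
  finally show ?case .
qed

text \<open>Homogeneity of degree \<open>n\<close> makes the range of \<open>k\<close> in
  \<open>Tsum\<close> exactly the set of insertion positions, so one step of the symmetrizer
  recursion is left multiplication by a letter.\<close>

lemma Tsum_prep:
  assumes "x \<in> X" "fins X p" "\<And>v. p v \<noteq> 0 \<Longrightarrow> length v = n"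
  shows "Tsum rk q n (prep x p) = qsh (delta [x]) p"
proof
  fix u
  let ?I = "{v. p v \<noteq> 0}"
  have fin: "finite ?I" by (rule fins_finite[OF assms(2)])
  have "Tsum rk q n (prep x p) u = (\<Sum>k\<le>n. \<Sum>v\<in>?I. p v * (qw x (take k v) * delta (insw x k v) u))"
    unfolding Tsum_def prep_decomp[OF fin]
  proof (rule sum.cong[OF refl])
    fix k assume "k \<in> {..n}"
    then have "k \<le> length v" if "v \<in> ?I" for v using assms(3) that by simp
    from Lk_sum_delta[OF fin, of k "\<lambda>v. v" p x, OF this]
    show "Lk rk q k (\<lambda>u. \<Sum>v\<in>?I. p v * delta (x # v) u) u
        = (\<Sum>v\<in>?I. p v * (qw x (take k v) * delta (insw x k v) u))" by (rule fun_cong)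
  qed
  also have "\<dots> = (\<Sum>v\<in>?I. p v * (\<Sum>k\<le>n. qw x (take k v) * delta (insw x k v) u))"
    by (subst sum.swap) (simp add: sum_distrib_left)
  also have "\<dots> = (\<Sum>v\<in>?I. p v * qsh (delta [x]) (delta v) u)"
  proof (rule sum.cong)
    fix v assume "v \<in> ?I"
    then have "length v = n" "set v \<subseteq> X" using assms(2,3) by (auto simp: fins_def)
    then show "p v * (\<Sum>k\<le>n. qw x (take k v) * delta (insw x k v) u) = p v * qsh (delta [x]) (delta v) u"
      using qsh_letter_delta[OF assms(1), of v] by simp
  qed simp
  also have "\<dots> = qsh (delta [x]) (\<lambda>u. \<Sum>v\<in>?I. p v * delta v u) u"
    unfolding qsh_sum_right[OF fin] ..
  also have "\<dots> = qsh (delta [x]) p u" unfolding delta_decomp[OF fin, symmetric] ..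
  finally show "Tsum rk q n (prep x p) u = qsh (delta [x]) p u" .
qed

lemma qsh_letter_decomp:
  assumes "x \<in> X" "fins X p"
  shows "qsh (delta [x]) p = (\<lambda>u. \<Sum>v\<in>{v. p v \<noteq> 0}. p v *
    (\<Sum>k\<le>length v. qw x (take k v) * delta (insw x k v) u))"
proof -
  let ?I = "{v. p v \<noteq> 0}"
  have fin: "finite ?I" by (rule fins_finite[OF assms(2)])
  have "qsh (delta [x]) p = qsh (delta [x]) (\<lambda>u. \<Sum>v\<in>?I. p v * delta v u)"
    unfolding delta_decomp[OF fin, symmetric] ..
  also have "\<dots> = (\<lambda>u. \<Sum>v\<in>?I. p v * qsh (delta [x]) (delta v) u)"
    by (rule qsh_sum_right[OF fin])
  also have "\<dots> = (\<lambda>u. \<Sum>v\<in>?I. p v * (\<Sum>k\<le>length v. qw x (take k v) * delta (insw x k v) u))"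
    using assms by (intro ext sum.cong refl) (auto simp: qsh_letter_delta fins_def)
  finally show ?thesis .
qed

lemma insw_closed: "x \<in> X \<Longrightarrow> set v \<subseteq> X \<Longrightarrow> set (insw x k v) \<subseteq> X"
  using rk_closed set_take_subset[of k v] set_drop_subset[of k v] by auto

lemma fins_qsh_letter:
  assumes "x \<in> X" "fins X p"
  shows "fins X (qsh (delta [x]) p)"
  unfolding qsh_letter_decomp[OF assms]
proof (rule fins_sum[OF fins_finite[OF assms(2)]])
  fix v assume "v \<in> {v. p v \<noteq> 0}"
  then have "set v \<subseteq> X" using assms(2) by (auto simp: fins_def)
  then show "fins X (\<lambda>u. \<Sum>k\<le>length v. qw x (take k v) * delta (insw x k v) u)"
    using assms(1) by (intro fins_sum fins_delta insw_closed) auto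
qed

lemma qsh_letter_nonzero:
  assumes "x \<in> X" "fins X p" "qsh (delta [x]) p u \<noteq> 0"
  shows "\<exists>v k. p v \<noteq> 0 \<and> k \<le> length v \<and> u = insw x k v"
proof -
  obtain v where v: "p v \<noteq> 0"
      "p v * (\<Sum>k\<le>length v. qw x (take k v) * delta (insw x k v) u) \<noteq> 0"
    using assms(3) unfolding qsh_letter_decomp[OF assms(1,2)]
    by (elim sum.not_neutral_contains_not_neutral) auto
  then have "(\<Sum>k\<le>length v. qw x (take k v) * delta (insw x k v) u) \<noteq> 0" by auto
  then obtain k where "k \<in> {..length v}" "qw x (take k v) * delta (insw x k v) u \<noteq> 0"
    by (rule sum.not_neutral_contains_not_neutral)
  then show ?thesis using v(1) by (auto simp: delta_def split: if_splits)
qed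

text \<open>Both properties are carried through one induction, since rewriting the recursion by
  \<open>Tsum_prep\<close> requires both of them for the shorter word.\<close>

lemma omegaw_props:
  assumes "set w \<subseteq> X"
  shows "fins X (om w) \<and> (\<forall>u. om w u \<noteq> 0 \<longrightarrow> length u = length w)"
  using assms
proof (induction w)
  case Nil
  show ?case using fins_delta[of "[]" X] by (auto simp: delta_def)
next
  case (Cons x w)
  then have eq: "om (x # w) = qsh (delta [x]) (om w)" using Tsum_prep[of x "om w"] by auto
  have "length u = length (x # w)" if "om (x # w) u \<noteq> 0" for u
  proof -
    have "x \<in> X" "fins X (om w)" "qsh (delta [x]) (om w) u \<noteq> 0"
      using that Cons unfolding eq by auto
    from qsh_letter_nonzero[OF this] obtain v k where "om w v \<noteq> 0" "k \<le> length v" "u = insw x k v"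
      by blast
    then show ?thesis using Cons by auto
  qed
  then show ?case
    using Cons fins_qsh_letter[of x "om w"] by (simp add: eq del: omegaw.simps)
qed

lemma omegaw_fins: "set w \<subseteq> X \<Longrightarrow> fins X (om w)"
  using omegaw_props by blast

lemma omegaw_length: "set w \<subseteq> X \<Longrightarrow> om w u \<noteq> 0 \<Longrightarrow> length u = length w"
  using omegaw_props by blast

lemma fins_supX: "fins X p \<Longrightarrow> supX X p"
  by (simp add: fins_def supX_def)

lemma omegaw_supX: "set w \<subseteq> X \<Longrightarrow> supX X (om w)"
  by (simp add: omegaw_fins fins_supX)

lemma omegaw_Cons: "x \<in> X \<Longrightarrow> set w \<subseteq> X \<Longrightarrow> om (x # w) = qsh (delta [x]) (om w)"
  using Tsum_prep[OF _ omegaw_fins, of x w] omegaw_length by auto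

declare omegaw.simps(2) [simp del]

lemma omegaw_single: "x \<in> X \<Longrightarrow> om [x] = delta [x]"
  by (simp add: omegaw_Cons qsh_one_right)

text \<open>By associativity \<open>om\<close> sends concatenation to the product, which is why the
  image of the symmetrizer is an algebra generated by letters.\<close>

lemma omegaw_append:
  "set v \<subseteq> X \<Longrightarrow> set w \<subseteq> X \<Longrightarrow> om (v @ w) = qsh (om v) (om w)"
proof (induction v)
  case Nil
  show ?case by (simp add: qsh_one_left)
next
  case (Cons x v)
  then show ?case
    by (simp add: omegaw_Cons qsh_assoc supX_delta omegaw_supX)
qed

lemma nmu_delta: "nmu rk q (delta w) = om w"
  by (simp add: nmu_def lin_delta)

lemma nmu_sum_delta:
  "finite I \<Longrightarrow> nmu rk q (\<lambda>u. \<Sum>i\<in>I. cf i * delta (h i) u) = (\<lambda>u. \<Sum>i\<in>I. cf i * om (h i) u)"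
  unfolding nmu_def using finite_smul_delta[of 1] by (subst lin_sum) (simp_all add: lin_delta)

lemma nmu_decomp: "nmu rk q f = (\<lambda>u. \<Sum>w\<in>{w. f w \<noteq> 0}. f w * om w u)"
  by (simp add: nmu_def lin_def)

lemma nmu_add: "fins X f \<Longrightarrow> fins X g \<Longrightarrow> nmu rk q (\<lambda>u. f u + g u) = (\<lambda>u. nmu rk q f u + nmu rk q g u)"
  unfolding nmu_def by (rule lin_add) (auto simp: fins_def)

lemma nmu_smul: "fins X f \<Longrightarrow> nmu rk q (\<lambda>u. s * f u) = (\<lambda>u. s * nmu rk q f u)"
  unfolding nmu_def by (rule lin_smul) (auto simp: fins_def)

lemma nmu_tens:
  assumes "fins X f" "fins X g"
  shows "nmu rk q (tens f g) = qsh (nmu rk q f) (nmu rk q g)"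
proof
  fix u
  let ?F = "{w. f w \<noteq> 0}" and ?G = "{w. g w \<noteq> 0}"
  have F: "finite ?F" and G: "finite ?G" using assms by (auto simp: fins_def)
  have FX: "set v \<subseteq> X" if "v \<in> ?F" for v using assms that by (auto simp: fins_def)
  have GX: "set v \<subseteq> X" if "v \<in> ?G" for v using assms that by (auto simp: fins_def)
  have "nmu rk q (tens f g) u = (\<Sum>z\<in>?F \<times> ?G. (f (fst z) * g (snd z)) * om (fst z @ snd z) u)"
    unfolding tens_decomp[OF F G] case_prod_unfold using F G by (subst nmu_sum_delta) auto
  also have "\<dots> = (\<Sum>v\<in>?F. \<Sum>w\<in>?G. (f v * g w) * om (v @ w) u)"
    by (simp add: sum.cartesian_product case_prod_unfold)
  also have "\<dots> = (\<Sum>v\<in>?F. f v * (\<Sum>w\<in>?G. g w * qsh (om v) (om w) u))"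
    using FX GX by (auto simp: sum_distrib_left omegaw_append mult.assoc intro!: sum.cong)
  also have "\<dots> = qsh (nmu rk q f) (nmu rk q g) u"
    unfolding nmu_decomp qsh_sum_left[OF F] qsh_sum_right[OF G] ..
  finally show "nmu rk q (tens f g) u = qsh (nmu rk q f) (nmu rk q g) u" .
qed

lemma nichols_eq_span: "nichols X rk q = spanK {om w | w. set w \<subseteq> X}"
proof (intro equalityI subsetI)
  fix h assume "h \<in> nichols X rk q"
  then obtain f where f: "fins X f" "h = nmu rk q f" by (auto simp: nichols_def)
  show "h \<in> spanK {om w | w. set w \<subseteq> X}"
    unfolding f(2) nmu_decomp
  proof (rule spanK_sum)
    show "finite {w. f w \<noteq> 0}" using f(1) by (rule fins_finite)
    fix w assume "w \<in> {w. f w \<noteq> 0}"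
    then have "set w \<subseteq> X" using f(1) unfolding fins_def by blast
    then show "om w \<in> spanK {om w | w. set w \<subseteq> X}" by (intro spanK_base) blast
  qed
next
  fix h assume "h \<in> spanK {om w | w. set w \<subseteq> X}"
  then have "\<exists>f. fins X f \<and> h = nmu rk q f"
  proof (induction rule: spanK_induct)
    case zero
    show ?case by (intro exI[of _ "\<lambda>_. 0"]) (simp add: nmu_decomp fins_zero)
  next
    case (step g p s)
    then obtain f w where "fins X f" "p = nmu rk q f" "set w \<subseteq> X" "g = om w" by blast
    then show ?case
      by (intro exI[of _ "\<lambda>u. f u + s * delta w u"])
        (simp add: fins_add fins_smul fins_delta nmu_add nmu_smul nmu_delta)
  qed
  then show "h \<in> nichols X rk q" unfolding nichols_def by blast
qed

lemma omegaw_nichols: "set w \<subseteq> X \<Longrightarrow> om w \<in> nichols X rk q"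
  unfolding nichols_eq_span by (intro spanK_base) blast

lemma nichols_fins: "p \<in> nichols X rk q \<Longrightarrow> fins X p"
  unfolding nichols_eq_span
proof (induction rule: spanK_induct)
  case zero
  then show ?case by (rule fins_zero)
next
  case (step f p s)
  then have "fins X f" using omegaw_fins by blast
  then show ?case by (intro fins_add fins_smul step)
qed

lemma act_omegaw:
  assumes "x \<in> X" "set w \<subseteq> X"
  shows "act x (om w) = (\<lambda>u. qw x w * om (map (rk x) w) u)"
  using assms(2)
proof (induction w)
  case Nil
  show ?case by (simp add: act_delta_nil qw_def)
next
  case (Cons y w)
  have c: "rk x y \<in> X" "set (map (rk x) w) \<subseteq> X"
    using Cons.prems assms(1) rk_closed by auto
  have "act x (om (y # w)) = qsh (act x (delta [y])) (act x (om w))"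
    using Cons.prems by (simp add: omegaw_Cons act_qsh assms supX_delta omegaw_supX)
  also have "\<dots> = (\<lambda>u. q x y * (qw x w * qsh (delta [rk x y]) (om (map (rk x) w)) u))"
    using Cons assms(1) act_delta[of x "[y]"] by (simp add: qsh_smul_left qsh_smul_right qw_def)
  also have "\<dots> = (\<lambda>u. qw x (y # w) * om (map (rk x) (y # w)) u)"
    using c by (simp add: omegaw_Cons qw_def mult.assoc)
  finally show ?case .
qed

lemma nichols_qsh_letter:
  assumes "x \<in> X" "p \<in> nichols X rk q" shows "qsh (delta [x]) p \<in> nichols X rk q"
  using assms(2) unfolding nichols_eq_span
proof (induction rule: spanK_induct)
  case zero
  then show ?case by (simp add: qsh_zero_right spanK_zero)
next
  case (step f p s)
  then obtain w where w: "set w \<subseteq> X" "f = om w" by blast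
  have "om (x # w) \<in> spanK {om w | w. set w \<subseteq> X}" using w assms(1)
    by (intro spanK_base CollectI exI[of _ "x # w"]) simp
  then show ?case
    using step(3) w assms(1)
    by (simp add: qsh_add_right qsh_smul_right omegaw_Cons[symmetric] spanK_add spanK_smul)
qed

lemma nichols_add: "p \<in> nichols X rk q \<Longrightarrow> r \<in> nichols X rk q \<Longrightarrow> (\<lambda>u. p u + r u) \<in> nichols X rk q"
  unfolding nichols_eq_span by (rule spanK_add)

lemma nichols_smul: "p \<in> nichols X rk q \<Longrightarrow> (\<lambda>u. s * p u) \<in> nichols X rk q"
  unfolding nichols_eq_span by (rule spanK_smul)

lemma nichols_zero: "(\<lambda>u. 0) \<in> nichols X rk q"
  unfolding nichols_eq_span by (rule spanK_zero)

lemma rder_omegaw_Cons: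
  assumes "x \<in> X" "set w \<subseteq> X"
  shows "rder y (om (x # w)) =
    (\<lambda>u. qsh (delta [x]) (rder y (om w)) u + (if y = x then 1 else 0) * act x (om w) u)"
  by (simp add: omegaw_Cons assms rder_qsh_letter)

lemma rder_omegaw_nichols: "set w \<subseteq> X \<Longrightarrow> rder y (om w) \<in> nichols X rk q"
proof (induction w)
  case Nil
  show ?case by (simp add: rder_delta_nil nichols_zero)
next
  case (Cons x w)
  then have "act x (om w) \<in> nichols X rk q"
    by (simp add: act_omegaw nichols_smul omegaw_nichols map_rk_closed del: set_map)
  then show ?case
    using Cons by (simp add: rder_omegaw_Cons nichols_add nichols_smul nichols_qsh_letter)
qed

lemma nichols_rder: "p \<in> nichols X rk q \<Longrightarrow> rder y p \<in> nichols X rk q"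
  unfolding nichols_eq_span
proof (induction rule: spanK_induct)
  case zero
  then show ?case by (simp add: rder_zero spanK_zero)
next
  case (step f p s)
  show ?case
  proof -
    obtain w where "set w \<subseteq> X" "f = om w" using step(1) by blast
    then have "rder y f \<in> spanK {om w | w. set w \<subseteq> X}"
      using rder_omegaw_nichols[of w y] by (simp add: nichols_eq_span)
    then show ?thesis
      unfolding rder_add rder_smul by (intro spanK_add spanK_smul step)
  qed
qed

text \<open>Fixing the right tensor factor of the coproduct to \<open>w\<close> amounts to applying
  right derivations along \<open>w\<close>, and these preserve the Nichols algebra.\<close>

lemma nichols_columns: "p \<in> nichols X rk q \<Longrightarrow> (\<lambda>u. p (u @ w)) \<in> nichols X rk q"
proof (induction w arbitrary: p rule: rev_induct)
  case (snoc y w)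
  from snoc.IH[OF nichols_rder[OF snoc.prems, of y]] show ?case by (simp add: rder_def)
qed simp

text \<open>The columns of the coproduct always lie in the Nichols algebra, so only the rows, that
  is iterated left derivatives, have to be checked.\<close>

lemma coprod_in_span:
  assumes "p \<in> nichols X rk q" and "\<And>u. (\<lambda>w. p (u @ w)) \<in> spanK A"
  shows "coprod p \<in> spanK {ptens x y | x y. x \<in> nichols X rk q \<and> y \<in> spanK A}"
  unfolding nichols_eq_span
proof (rule ptens_span)
  have "finite {u. p u \<noteq> 0}" using nichols_fins[OF assms(1)] by (rule fins_finite)
  \<comment> \<open>Every nonzero row is indexed by a prefix of a word in the finite support of
    \<open>p\<close>.\<close>
  then have "finite (\<Union>v\<in>{u. p u \<noteq> 0}. (\<lambda>i. take i v) ` {..length v})" by simp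
  then show "finite {u. \<exists>w. coprod p (u, w) \<noteq> 0}"
  proof (rule finite_subset[rotated], intro subsetI)
    fix u assume "u \<in> {u. \<exists>w. coprod p (u, w) \<noteq> 0}"
    then obtain w where "p (u @ w) \<noteq> 0" by (auto simp: coprod_def)
    moreover have "u = take (length u) (u @ w)" "length u \<le> length (u @ w)" by auto
    ultimately show "u \<in> (\<Union>v\<in>{u. p u \<noteq> 0}. (\<lambda>i. take i v) ` {..length v})" by blast
  qed
  show "(\<lambda>w. coprod p (u, w)) \<in> spanK A" for u using assms(2) by (simp add: coprod_def)
  show "(\<lambda>u. coprod p (u, w)) \<in> spanK {om w | w. set w \<subseteq> X}" for w
    using nichols_columns[OF assms(1), of w] by (simp add: coprod_def nichols_eq_span)
qed

end

section \<open>Degrees in the enveloping group\<close>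

lemma gxeq_refl: "gxeq X rk u u"
  by (simp add: gxeq_def grefl)

lemma gxeq_sym: "gxeq X rk u w \<Longrightarrow> gxeq X rk w u"
  unfolding gxeq_def by (rule gsym)

lemma gxeq_trans: "gxeq X rk u v \<Longrightarrow> gxeq X rk v w \<Longrightarrow> gxeq X rk u w"
  unfolding gxeq_def by (rule gtrans)

lemma gxeq_append: 
  assumes "gxeq X rk u u'" "gxeq X rk w w'" shows "gxeq X rk (u @ w) (u' @ w')"
proof (rule gxeq_trans)
  show "gxeq X rk (u @ w) (u' @ w)"
    using gctx[OF assms(1)[unfolded gxeq_def], of "[]"] by (simp add: gxeq_def)
  show "gxeq X rk (u' @ w) (u' @ w')"
    using gctx[OF assms(2)[unfolded gxeq_def], of _ "[]"] by (simp add: gxeq_def)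
qed

lemma gxeq_Cons: "gxeq X rk u w \<Longrightarrow> gxeq X rk (x # u) (x # w)"
  using gxeq_append[OF gxeq_refl, of X rk u w "[x]"] by simp

lemma gxeq_swap: "x \<in> X \<Longrightarrow> y \<in> X \<Longrightarrow> gxeq X rk (x # y # r) (rk x y # x # r)"
  using gxeq_append[of X rk "[x, y]" "[rk x y, x]" r r] grel[of x X y rk] gxeq_refl[of X rk r]
  by (simp add: gxeq_def)

section \<open>Left skew derivations and homogeneous components\<close>

context rack_cocycle
begin

text \<open>The first letter of an insertion word is either \<open>x\<close> itself or a former
  first letter \<open>y\<close> turned into \<open>rk x y\<close>. Indexing by \<open>rk x y\<close>
  avoids the inverse of \<open>rk x\<close>; the induction on the last letter works because left and
  right derivations commute.\<close>

lemma lder_qsh_letter: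
  assumes "x \<in> X" "y \<in> X"
  shows "lder (rk x y) (qsh (delta [x]) p) =
    (\<lambda>u. (if x = rk x y then 1 else 0) * p u + q x y * qsh (delta [x]) (lder y p) u)"
proof
  fix u
  show "lder (rk x y) (qsh (delta [x]) p) u =
    (if x = rk x y then 1 else 0) * p u + q x y * qsh (delta [x]) (lder y p) u"
  proof (induction u arbitrary: p rule: rev_induct)
    case Nil
    show ?case by (auto simp: lder_def qsh_letter qsh_nil delta_def)
  next
    case (snoc z u)
    have "lder (rk x y) (qsh (delta [x]) p) (u @ [z]) = lder (rk x y) (rder z (qsh (delta [x]) p)) u"
      by (simp add: rder_def lder_def)
    also have "\<dots> = (if x = rk x y then 1 else 0) * rder z p u
        + q x y * qsh (delta [x]) (lder y (rder z p)) u
        + (if z = x then 1 else 0) * (q x y * act x (lder y p) u)"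
      unfolding rder_qsh_letter lder_add lder_smul snoc.IH lder_act[OF assms] ..
    also have "\<dots> = (if x = rk x y then 1 else 0) * rder z p u
        + q x y * rder z (qsh (delta [x]) (lder y p)) u"
      unfolding rder_qsh_letter rder_lder by (simp add: algebra_simps)
    finally show ?case by (simp add: rder_def)
  qed
qed

text \<open>The scalar with which the product of the \<open>g_x\<close> along the word sends
  \<open>v_y\<close> to a multiple of the basis vector at \<open>foldr rk w y\<close>.\<close>

primrec qd :: "'a list \<Rightarrow> 'a \<Rightarrow> 'k" where
  "qd [] y = 1"
| "qd (x # w) y = q x (foldr rk w y) * qd w y"

lemma foldr_rk_closed: "set w \<subseteq> X \<Longrightarrow> y \<in> X \<Longrightarrow> foldr rk w y \<in> X"
  by (induction w) (auto simp: rk_closed)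

lemma foldr_rk_surj: "set w \<subseteq> X \<Longrightarrow> z \<in> X \<Longrightarrow> \<exists>y\<in>X. foldr rk w y = z"
proof (induction w arbitrary: z)
  case (Cons x w)
  then obtain z' where "z' \<in> X" "rk x z' = z" using rk_surj[of x z] by auto
  then show ?case using Cons.IH[of z'] Cons.prems by auto
qed auto

lemma lder_delta_nil: "lder y (delta []) = (\<lambda>u. 0)"
  by (simp add: lder_def delta_def)

text \<open>The left Leibniz rule: to differentiate the right factor, \<open>v_y\<close> is pulled
  to the front through the left factor, which changes its index to \<open>foldr rk w y\<close> and
  costs \<open>qd w y\<close>.\<close>

lemma lder_qsh_omegaw:
  assumes "set w \<subseteq> X" "y \<in> X" "supX X p"
  shows "lder (foldr rk w y) (qsh (om w) p) =
    (\<lambda>u. qsh (lder (foldr rk w y) (om w)) p u + qd w y * qsh (om w) (lder y p) u)"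
  using assms(1)
proof (induction w)
  case Nil
  show ?case by (simp add: qsh_one_left lder_delta_nil qsh_zero_left)
next
  case (Cons x w)
  let ?Y = "foldr rk w y" and ?c = "(if x = rk x (foldr rk w y) then 1 else 0) :: 'k"
  have x: "x \<in> X" and w: "set w \<subseteq> X" and Y: "?Y \<in> X"
    using Cons.prems assms foldr_rk_closed by auto
  note sups = supX_delta omegaw_supX[OF w] supX_lder[OF omegaw_supX[OF w]] assms(3) supX_lder[OF assms(3)]
  have "lder (rk x ?Y) (qsh (om (x # w)) p) = lder (rk x ?Y) (qsh (delta [x]) (qsh (om w) p))"
    using x by (simp add: omegaw_Cons x w qsh_assoc sups)
  also have "\<dots> = (\<lambda>u. ?c * qsh (om w) p u + q x ?Y * (qsh (delta [x]) (qsh (lder ?Y (om w)) p) u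
      + qd w y * qsh (delta [x]) (qsh (om w) (lder y p)) u))"
    unfolding lder_qsh_letter[OF x Y] Cons.IH[OF w] qsh_add_right qsh_smul_right ..
  also have "\<dots> = (\<lambda>u. qsh (lder (rk x ?Y) (om (x # w))) p u
      + q x ?Y * qd w y * qsh (om (x # w)) (lder y p) u)"
    using x by (simp add: omegaw_Cons x w lder_qsh_letter[OF x Y] qsh_add_left qsh_smul_left
        qsh_zero_left qsh_assoc sups algebra_simps)
  finally show ?case by simp
qed

text \<open>Each letter is pulled to the front through the letters before it; the summand survives
  when the resulting index is \<open>Y\<close>.\<close>

lemma lder_omegaw:
  assumes "set w \<subseteq> X" "Y \<in> X"
  shows "lder Y (om w) = (\<lambda>u. \<Sum>i<length w. (if foldr rk (take i w) (w ! i) = Y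
    then qd (take i w) (w ! i) else 0) * om (take i w @ drop (Suc i) w) u)"
  using assms
proof (induction w arbitrary: Y)
  case Nil
  show ?case by (simp add: lder_delta_nil)
next
  case (Cons x w)
  have x: "x \<in> X" and w: "set w \<subseteq> X" using Cons.prems by auto
  obtain y where y: "y \<in> X" "Y = rk x y" using rk_surj[OF x Cons.prems(2)] by blast
  let ?cf = "\<lambda>i. (if foldr rk (take i w) (w ! i) = y then qd (take i w) (w ! i) else 0)"
  have "lder Y (om (x # w)) = (\<lambda>u. (if x = Y then 1 else 0) * om w u
      + q x y * qsh (delta [x]) (\<lambda>u. \<Sum>i<length w. ?cf i * om (take i w @ drop (Suc i) w) u) u)"
    unfolding omegaw_Cons[OF x w] y(2) lder_qsh_letter[OF x y(1)] Cons.IH[OF w y(1)] ..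
  also have "\<dots> = (\<lambda>u. (if x = Y then 1 else 0) * om w u
      + (\<Sum>i<length w. (q x y * ?cf i) * om (x # take i w @ drop (Suc i) w) u))"
  proof -
    have "set (take i w @ drop (Suc i) w) \<subseteq> X" for i
      using w set_take_subset[of i w] set_drop_subset[of "Suc i" w] by auto
    then show ?thesis
      unfolding qsh_sum_right[OF finite_lessThan]
      by (simp only: omegaw_Cons[OF x] sum_distrib_left mult.assoc)
  qed
  also have "\<dots> = (\<lambda>u. (if x = Y then 1 else 0) * om w u
      + (\<Sum>i<length w. (if foldr rk (take (Suc i) (x # w)) ((x # w) ! Suc i) = Y
        then qd (take (Suc i) (x # w)) ((x # w) ! Suc i) else 0)
        * om (take (Suc i) (x # w) @ drop (Suc (Suc i)) (x # w)) u))"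
  \<comment> \<open>Injectivity of \<open>rk x\<close> lets the test at \<open>y\<close> for the
    tail be restated as a test at \<open>Y = rk x y\<close> for the longer word.\<close>
  proof (intro ext arg_cong2[where f = "(+)"] sum.cong refl)
    fix u i assume "i \<in> {..<length w}"
    then have i: "w ! i \<in> X" "set (take i w) \<subseteq> X"
      using w nth_mem[of i w] set_take_subset[of i w] by auto
    then have "rk x (foldr rk (take i w) (w ! i)) = Y \<longleftrightarrow> foldr rk (take i w) (w ! i) = y"
      using rk_inj[OF x foldr_rk_closed y(1)] y(2) by auto
    then show "q x y * ?cf i * om (x # take i w @ drop (Suc i) w) u
      = (if foldr rk (take (Suc i) (x # w)) ((x # w) ! Suc i) = Y
        then qd (take (Suc i) (x # w)) ((x # w) ! Suc i) else 0)
        * om (take (Suc i) (x # w) @ drop (Suc (Suc i)) (x # w)) u"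
      by simp
  qed
  also have "\<dots> = (\<lambda>u. \<Sum>i<length (x # w). (if foldr rk (take i (x # w)) ((x # w) ! i) = Y
    then qd (take i (x # w)) ((x # w) ! i) else 0) * om (take i (x # w) @ drop (Suc i) (x # w)) u)"
    by (simp only: length_Cons sum.lessThan_Suc_shift) simp
  finally show ?case .
qed

text \<open>Words with the same degree in the enveloping group; the last clause makes them act on \<open>V\<close> in the
  same way.\<close>

definition req :: "'a list \<Rightarrow> 'a list \<Rightarrow> bool" where
  "req v w \<longleftrightarrow> length v = length w \<and> gxeq X rk v w
    \<and> (\<forall>y\<in>X. foldr rk v y = foldr rk w y \<and> qd v y = qd w y)"

text \<open>Its span serves as a homogeneous component: membership fixes length and group degree of
  the support as well as the twist in the left Leibniz rule.\<close>

definition homg :: "'a list \<Rightarrow> ('a list \<Rightarrow> 'k) set" where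
  "homg w = {om v | v. set v \<subseteq> X \<and> req v w}"

lemma req_refl: "req w w"
  by (simp add: req_def gxeq_refl)

lemma req_trans: "req u v \<Longrightarrow> req v w \<Longrightarrow> req u w"
  unfolding req_def using gxeq_trans by auto

lemma qd_append: "qd (v @ w) y = qd v (foldr rk w y) * qd w y"
  by (induction v) (auto simp: mult.assoc)

lemma req_append: "set w' \<subseteq> X \<Longrightarrow> req v v' \<Longrightarrow> req w w' \<Longrightarrow> req (v @ w) (v' @ w')"
  unfolding req_def by (auto simp: gxeq_append qd_append foldr_rk_closed)

text \<open>Moving the last letter to the front by braidings does not change the product in the
  enveloping group. Hence the words occurring in the powers of \<open>P\<close> on
  \<open>a b c d\<close> all have one degree.\<close>

lemma req_rotate:
  assumes "set v \<subseteq> X" "d \<in> X"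
  shows "req (foldr rk v d # v) (v @ [d])"
  using assms(1)
proof (induction v)
  case Nil
  show ?case by (simp add: req_refl)
next
  case (Cons x v)
  let ?D = "foldr rk v d"
  have x: "x \<in> X" and v: "set v \<subseteq> X" and D: "?D \<in> X"
    using Cons.prems assms(2) foldr_rk_closed by auto
  \<comment> \<open>One adjacent swap: the degree is kept by the defining relation, the action by
    distributivity, and the scalars by the cocycle condition.\<close>
  have "req (rk x ?D # x # v) (x # ?D # v)"
    unfolding req_def
  proof (intro conjI ballI)
    show "gxeq X rk (rk x ?D # x # v) (x # ?D # v)" by (rule gxeq_sym[OF gxeq_swap[OF x D]])
    fix y assume "y \<in> X"
    then have M: "foldr rk v y \<in> X" using v foldr_rk_closed by blast
    show "foldr rk (rk x ?D # x # v) y = foldr rk (x # ?D # v) y"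
      using rk_dist[OF x D M] by simp
    show "qd (rk x ?D # x # v) y = qd (x # ?D # v) y"
      using cocyc[OF x D M] by (simp add: mult.assoc[symmetric])
  qed simp
  moreover have "req ([x] @ ?D # v) ([x] @ v @ [d])"
    by (rule req_append) (use Cons.IH[OF v] v assms(2) in \<open>auto simp: req_refl\<close>)
  ultimately show ?case using req_trans by simp
qed

lemma qsh_spanK:
  assumes "p \<in> spanK A" "r \<in> spanK B"
    and AB: "\<And>a b. a \<in> A \<Longrightarrow> b \<in> B \<Longrightarrow> qsh a b \<in> spanK D"
  shows "qsh p r \<in> spanK D"
  using assms(1)
proof (induction rule: spanK_induct)
  case zero
  show ?case by (simp add: qsh_zero_left spanK_zero)
next
  case (step a p s)
  note a = step(1)
  have "qsh a r \<in> spanK D"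
    using assms(2)
  proof (induction rule: spanK_induct)
    case zero
    show ?case by (simp add: qsh_zero_right spanK_zero)
  next
    case (step b r s)
    then show ?case
      unfolding qsh_add_right qsh_smul_right using AB[OF a] by (intro spanK_add spanK_smul)
  qed
  then show ?case
    unfolding qsh_add_left qsh_smul_left using step by (intro spanK_add spanK_smul)
qed

lemma qsh_homg:
  assumes "p \<in> spanK (homg v)" "r \<in> spanK (homg w)" "set w \<subseteq> X"
  shows "qsh p r \<in> spanK (homg (v @ w))"
  using assms(1,2)
proof (rule qsh_spanK)
  fix a b assume "a \<in> homg v" "b \<in> homg w"
  then obtain v' w' where "set v' \<subseteq> X" "req v' v" "a = om v'" "set w' \<subseteq> X" "req w' w" "b = om w'"
    unfolding homg_def by blast
  then have "qsh a b = om (v' @ w')" "set (v' @ w') \<subseteq> X" "req (v' @ w') (v @ w)"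
    using req_append[OF assms(3)] by (auto simp: omegaw_append)
  then show "qsh a b \<in> spanK (homg (v @ w))"
    unfolding homg_def by (intro spanK_base CollectI exI[of _ "v' @ w'"]) simp
qed

lemma gxeq_insw: "x \<in> X \<Longrightarrow> set t \<subseteq> X \<Longrightarrow> gxeq X rk (map (rk x) t @ x # r) (x # t @ r)"
proof (induction t)
  case Nil
  show ?case by (simp add: gxeq_refl)
next
  case (Cons y t)
  then have "gxeq X rk (map (rk x) (y # t) @ x # r) (rk x y # x # t @ r)"
    using gxeq_Cons[of X rk _ _ "rk x y"] by simp
  moreover have "gxeq X rk (rk x y # x # t @ r) (x # y # t @ r)"
    using gxeq_sym[OF gxeq_swap[of x X y rk "t @ r"]] Cons.prems by simp
  ultimately show ?case using gxeq_trans by fastforce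
qed

lemma omegaw_gxeq: "set w \<subseteq> X \<Longrightarrow> om w u \<noteq> 0 \<Longrightarrow> gxeq X rk u w"
proof (induction w arbitrary: u)
  case Nil
  then show ?case by (auto simp: delta_def gxeq_refl split: if_splits)
next
  case (Cons x w)
  have x: "x \<in> X" and w: "set w \<subseteq> X" using Cons.prems by auto
  obtain v k where v: "om w v \<noteq> 0" "u = insw x k v"
    using qsh_letter_nonzero[OF x omegaw_fins[OF w], of u] Cons.prems(2) omegaw_Cons[OF x w] by auto
  have "set v \<subseteq> X" using v(1) omegaw_supX[OF w] by (simp add: supX_def)
  then have "gxeq X rk u (x # take k v @ drop k v)"
    unfolding v(2) using set_take_subset[of k v] by (intro gxeq_insw[OF x]) auto
  moreover have "gxeq X rk (x # v) (x # w)"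
    by (rule gxeq_Cons[OF Cons.IH[OF w v(1)]])
  ultimately show ?case using gxeq_trans by (metis append_take_drop_id)
qed

lemma homg_support:
  assumes "p \<in> spanK (homg w)" "p u \<noteq> 0"
  shows "length u = length w \<and> gxeq X rk u w"
  using assms
proof (induction rule: spanK_induct)
  case (step f p s)
  then obtain v where v: "set v \<subseteq> X" "req v w" "f = om v" unfolding homg_def by blast
  have "p u \<noteq> 0 \<or> f u \<noteq> 0" using step.prems by auto
  then show ?case
  proof
    assume "f u \<noteq> 0"
    then have "length u = length v" "gxeq X rk u v"
      using v omegaw_length[of v u] omegaw_gxeq[of v u] by auto
    then show ?thesis using v(2) gxeq_trans[of X rk u v w] unfolding req_def by auto
  qed (rule step.IH)
qed simp

text \<open>All words in a homogeneous \<open>p\<close> induce the same twist, so the Leibniz rule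
  for single words adds up with a common index and scalar.\<close>

lemma lder_qsh_homg:
  assumes "p \<in> spanK (homg w)" "y \<in> X" "supX X r"
  shows "lder (foldr rk w y) (qsh p r) =
    (\<lambda>u. qsh (lder (foldr rk w y) p) r u + qd w y * qsh p (lder y r) u)"
  using assms(1)
proof (induction rule: spanK_induct)
  case zero
  show ?case by (simp add: qsh_zero_left lder_def)
next
  case (step f p s)
  then obtain v where v: "set v \<subseteq> X" "req v w" "f = om v" unfolding homg_def by blast
  have "foldr rk v y = foldr rk w y" "qd v y = qd w y" using v(2) assms(2) by (auto simp: req_def)
  then have f: "lder (foldr rk w y) (qsh f r) =
      (\<lambda>u. qsh (lder (foldr rk w y) f) r u + qd w y * qsh f (lder y r) u)"
    using lder_qsh_omegaw[OF v(1) assms(2,3)] v(3) by simp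
  show ?case
    unfolding qsh_add_left qsh_smul_left lder_add lder_smul f step.IH by (simp add: algebra_simps)
qed

section \<open>Subalgebras generated by homogeneous elements\<close>

definition gensub :: "('a list \<Rightarrow> 'k) set \<Rightarrow> ('a list \<Rightarrow> 'k) set" where
  "gensub S = spanK {nmu rk q (tensl ws) | ws. set ws \<subseteq> S}"

context
  fixes S :: "('a list \<Rightarrow> 'k) set"
  assumes S_fins: "s \<in> S \<Longrightarrow> fins X s"
    and S_homg: "s \<in> S \<Longrightarrow> \<exists>w. set w \<subseteq> X \<and> nmu rk q s \<in> spanK (homg w)"
begin

lemma nmu_tensl_Cons:
  "s \<in> S \<Longrightarrow> set ws \<subseteq> S \<Longrightarrow> nmu rk q (tensl (s # ws)) = qsh (nmu rk q s) (nmu rk q (tensl ws))"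
  unfolding tensl_Cons using S_fins by (intro nmu_tens fins_tensl) auto

lemma nmu_tensl_Nil: "nmu rk q (tensl []) = delta []"
  by (simp add: tensl_def nmu_delta)

lemma nmu_nichols: "fins X f \<Longrightarrow> nmu rk q f \<in> nichols X rk q"
  unfolding nichols_def by blast

lemma gensub_nichols: "gensub S \<subseteq> nichols X rk q"
proof -
  have "{nmu rk q (tensl ws) | ws. set ws \<subseteq> S} \<subseteq> spanK {om w | w. set w \<subseteq> X}"
  proof
    fix h assume "h \<in> {nmu rk q (tensl ws) | ws. set ws \<subseteq> S}"
    then obtain ws where ws: "h = nmu rk q (tensl ws)" "set ws \<subseteq> S" by blast
    have "fins X (tensl ws)" by (rule fins_tensl) (use ws(2) S_fins in blast)
    then show "h \<in> spanK {om w | w. set w \<subseteq> X}"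
      unfolding ws(1) nichols_eq_span[symmetric] by (rule nmu_nichols)
  qed
  then show ?thesis unfolding gensub_def nichols_eq_span by (rule spanK_mono)
qed

lemma gensub_supX: "p \<in> gensub S \<Longrightarrow> supX X p"
  by (rule fins_supX[OF nichols_fins]) (rule subsetD[OF gensub_nichols])

lemma nmu_tensl_gensub: "set ws \<subseteq> S \<Longrightarrow> nmu rk q (tensl ws) \<in> gensub S"
  unfolding gensub_def by (intro spanK_base CollectI exI[of _ ws]) simp

lemma nmu_tensl_append:
  "set ws \<subseteq> S \<Longrightarrow> set vs \<subseteq> S \<Longrightarrow>
    nmu rk q (tensl (ws @ vs)) = qsh (nmu rk q (tensl ws)) (nmu rk q (tensl vs))"
proof (induction ws)
  case Nil
  show ?case by (simp add: nmu_tensl_Nil qsh_one_left)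
next
  case (Cons s ws)
  have "supX X (nmu rk q s)"
    using Cons.prems S_fins[of s] fins_supX[OF nichols_fins[OF nmu_nichols]] by simp
  then show ?case
    using Cons gensub_supX[OF nmu_tensl_gensub]
    by (simp add: nmu_tensl_Cons qsh_assoc)
qed

lemma gensub_qsh: "p \<in> gensub S \<Longrightarrow> r \<in> gensub S \<Longrightarrow> qsh p r \<in> gensub S"
  unfolding gensub_def
proof (rule qsh_spanK)
  fix a b assume "a \<in> {nmu rk q (tensl ws) |ws. set ws \<subseteq> S}" "b \<in> {nmu rk q (tensl ws) |ws. set ws \<subseteq> S}"
  then obtain ws vs where "set ws \<subseteq> S" "a = nmu rk q (tensl ws)" "set vs \<subseteq> S" "b = nmu rk q (tensl vs)"
    by blast
  then show "qsh a b \<in> spanK {nmu rk q (tensl ws) |ws. set ws \<subseteq> S}"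
    using nmu_tensl_gensub[of "ws @ vs"] nmu_tensl_append[of ws vs] by (simp add: gensub_def)
qed

lemma nmu_gensub: "s \<in> S \<Longrightarrow> nmu rk q s \<in> gensub S"
  using nmu_tensl_gensub[of "[s]"] by (simp add: tensl_singleton)

lemma gensub_homg: "set ws \<subseteq> S \<Longrightarrow> \<exists>w. set w \<subseteq> X \<and> nmu rk q (tensl ws) \<in> spanK (homg w)"
proof (induction ws)
  case Nil
  have "delta [] \<in> homg []" unfolding homg_def by (intro CollectI exI[of _ "[]"]) (simp add: req_refl)
  then show ?case by (intro exI[of _ "[]"]) (simp add: nmu_tensl_Nil spanK_base)
next
  case (Cons s ws)
  then obtain v w where "set v \<subseteq> X" "nmu rk q s \<in> spanK (homg v)"
      "set w \<subseteq> X" "nmu rk q (tensl ws) \<in> spanK (homg w)"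
    using S_homg[of s] by auto
  then show ?case
    using qsh_homg[of "nmu rk q s" v "nmu rk q (tensl ws)" w] nmu_tensl_Cons[of s ws] Cons.prems
    by (intro exI[of _ "v @ w"]) simp
qed

text \<open>A product of generators is supported in a single degree, so a predicate constant on each
  degree class either keeps it or kills it. This yields closure under both gradings.\<close>

lemma gensub_restrict:
  assumes "p \<in> gensub S"
    and "\<And>w. (\<forall>u. length u = length w \<and> gxeq X rk u w \<longrightarrow> P u)
      \<or> (\<forall>u. length u = length w \<and> gxeq X rk u w \<longrightarrow> \<not> P u)"
  shows "(\<lambda>u. if P u then p u else 0) \<in> gensub S"
  using assms(1) unfolding gensub_def
proof (induction rule: spanK_induct)
  case zero
  show ?case using spanK_zero by simp
next
  case (step f p s)
  have f: "(\<lambda>u. if P u then f u else 0) \<in> spanK {nmu rk q (tensl ws) |ws. set ws \<subseteq> S}"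
  proof -
    obtain w where w: "f \<in> spanK (homg w)" using step(1) gensub_homg by blast
    have "(\<lambda>u. if P u then f u else 0) = f \<or> (\<lambda>u. if P u then f u else 0) = (\<lambda>u. 0)"
      using assms(2)[of w]
    proof
      assume "\<forall>u. length u = length w \<and> gxeq X rk u w \<longrightarrow> P u"
      then show ?thesis using homg_support[OF w] by force
    next
      assume "\<forall>u. length u = length w \<and> gxeq X rk u w \<longrightarrow> \<not> P u"
      then show ?thesis using homg_support[OF w] by force
    qed
    then show ?thesis using spanK_base[OF step(1)] spanK_zero by auto
  qed
  have "(\<lambda>u. if P u then p u + s * f u else 0)
      = (\<lambda>u. (if P u then p u else 0) + s * (if P u then f u else 0))" by auto
  then show ?case using spanK_add[OF step.IH spanK_smul[OF f]] by simp
qed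

text \<open>By the twisted Leibniz rule, stability under left derivations only has to be known on
  generators.\<close>

lemma gensub_lder:
  assumes S_lder: "\<And>s y. s \<in> S \<Longrightarrow> y \<in> X \<Longrightarrow> lder y (nmu rk q s) \<in> gensub S"
    and "p \<in> gensub S"
  shows "lder y p \<in> gensub S"
proof -
  have gen: "y \<in> X \<Longrightarrow> lder y (nmu rk q (tensl ws)) \<in> gensub S" if "set ws \<subseteq> S" for ws y
    using that
  proof (induction ws arbitrary: y)
    case Nil
    show ?case by (simp add: nmu_tensl_Nil lder_delta_nil gensub_def spanK_zero)
  next
    case (Cons s ws)
    have s: "s \<in> S" and ws: "set ws \<subseteq> S" using Cons.prems by auto
    obtain w where w: "set w \<subseteq> X" "nmu rk q s \<in> spanK (homg w)" using S_homg[OF s] by blast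
    \<comment> \<open>The rule produces the derivation at \<open>foldr rk w z\<close>; to reach
      \<open>y\<close>, the right factor must be differentiated at the preimage
      \<open>z\<close>.\<close>
    obtain z where z: "z \<in> X" "foldr rk w z = y" using foldr_rk_surj[OF w(1) Cons.prems(1)] by blast
    let ?P = "nmu rk q (tensl ws)"
    have P: "?P \<in> gensub S" by (rule nmu_tensl_gensub[OF ws])
    have "lder y (nmu rk q (tensl (s # ws))) =
        (\<lambda>u. qsh (lder y (nmu rk q s)) ?P u + qd w z * qsh (nmu rk q s) (lder z ?P) u)"
      using lder_qsh_homg[OF w(2) z(1) gensub_supX[OF P]] nmu_tensl_Cons[OF s ws] z(2) by simp
    also have "\<dots> \<in> gensub S"
      using gensub_qsh[OF S_lder[OF s Cons.prems(1)] P]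
        gensub_qsh[OF nmu_gensub[OF s] Cons.IH[OF z(1) ws]]
      unfolding gensub_def by (intro spanK_add spanK_smul)
    finally show ?case .
  qed
  show ?thesis
  proof (cases "y \<in> X")
    case False
    then show ?thesis
      using lder_notin[OF gensub_supX[OF assms(2)]] by (simp add: gensub_def spanK_zero)
  next
    case True
    show ?thesis
      using assms(2) unfolding gensub_def
    proof (induction rule: spanK_induct)
      case zero
      then show ?case by (simp add: lder_def spanK_zero)
    next
      case (step f p s)
      then have "lder y f \<in> spanK {nmu rk q (tensl ws) |ws. set ws \<subseteq> S}"
        using gen[OF _ True] unfolding gensub_def by blast
      then show ?case unfolding lder_add lder_smul by (intro spanK_add spanK_smul step)
    qed
  qed
qed

lemma gensub_left_coideal:
  assumes S_lder: "\<And>s y. s \<in> S \<Longrightarrow> y \<in> X \<Longrightarrow> lder y (nmu rk q s) \<in> gensub S"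
  shows "left_coideal_subalg X rk q (gensub S)"
  unfolding left_coideal_subalg_def
proof (intro conjI ballI allI impI)
  show "gensub S \<subseteq> nichols X rk q" by (rule gensub_nichols)
  show "delta [] \<in> gensub S" using nmu_tensl_gensub[of "[]"] by (simp add: nmu_tensl_Nil)
  show "(\<lambda>u. p u + r u) \<in> gensub S" if "p \<in> gensub S" "r \<in> gensub S" for p r
    using that unfolding gensub_def by (rule spanK_add)
  show "(\<lambda>u. s * p u) \<in> gensub S" if "p \<in> gensub S" for p s
    using that unfolding gensub_def by (rule spanK_smul)
  show "nmu rk q (tens f g) \<in> gensub S"
    if "fins X f" "fins X g" "nmu rk q f \<in> gensub S" "nmu rk q g \<in> gensub S" for f g
    unfolding nmu_tens[OF that(1,2)] by (rule gensub_qsh[OF that(3,4)])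
  show "ncomp n p \<in> gensub S" if "p \<in> gensub S" for p n
    unfolding ncomp_def by (rule gensub_restrict[OF that]) auto
  show "gcomp X rk w0 p \<in> gensub S" if "p \<in> gensub S" for p w0
    unfolding gcomp_def
  proof (rule gensub_restrict[OF that])
    fix w
    show "(\<forall>u. length u = length w \<and> gxeq X rk u w \<longrightarrow> gxeq X rk u w0)
      \<or> (\<forall>u. length u = length w \<and> gxeq X rk u w \<longrightarrow> \<not> gxeq X rk u w0)"
      using gxeq_trans gxeq_sym by metis
  qed
  show "coprod p \<in> spanK {ptens x y |x y. x \<in> nichols X rk q \<and> y \<in> gensub S}"
    if "p \<in> gensub S" for p
    unfolding gensub_def
  proof (rule coprod_in_span)
    show "p \<in> nichols X rk q" using that gensub_nichols by blast
    show "(\<lambda>w. p (u @ w)) \<in> spanK {nmu rk q (tensl ws) |ws. set ws \<subseteq> S}" for u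
      using that unfolding gensub_def[symmetric]
    \<comment> \<open>The prefix \<open>u\<close> is stripped letter by letter, each time by a left
      derivation.\<close>
    proof (induction u arbitrary: p)
      case (Cons y u)
      show ?case using Cons.IH[OF gensub_lder[OF S_lder Cons.prems]] by (simp add: lder_def)
    qed simp
  qed
qed

end

end

section \<open>Slim Nichols algebras over braided racks\<close>

locale slim_rack = rack_cocycle +
  assumes q_nonzero: "x \<in> X \<Longrightarrow> y \<in> X \<Longrightarrow> q x y \<noteq> 0"
    and rk_comm: "x \<in> X \<Longrightarrow> y \<in> X \<Longrightarrow> rk x y = y \<Longrightarrow> rk y x = x"
    and rk_idem: "x \<in> X \<Longrightarrow> rk x x = x"
    and rk_braid: "x \<in> X \<Longrightarrow> y \<in> X \<Longrightarrow> rk x y \<noteq> y \<Longrightarrow> rk x (rk y x) = y"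
    and slim: "slim2 X rk q"
begin

text \<open>For a noncommuting pair the braiding permutes index pairs in a cycle of length three:
  (x, y), (x \<triangleright> y, x), (y, x \<triangleright> y).\<close>

lemma braid_triple:
  assumes "x \<in> X" "y \<in> X" "rk x y \<noteq> y"
  shows "rk (rk x y) x = y" "rk y (rk x y) = x"
proof -
  show "rk (rk x y) x = y"
    using rk_dist[of x y x] rk_idem[of x] rk_braid[of x y] assms by simp
  have "rk y x \<noteq> x" using rk_comm[of y x] assms by blast
  then show "rk y (rk x y) = x" using rk_braid[of y x] assms by blast
qed

lemma q_comm_invariant:
  assumes "x \<in> X" "y \<in> X" "z \<in> X" "rk y z = z"
  shows "q (rk x y) (rk x z) = q y z"
  using cocyc[OF assms(1-3)] assms(4) q_nonzero[OF assms(1,3)] by simp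

lemma nmu_diff:
  assumes "fins X f" "fins X g"
  shows "nmu rk q (\<lambda>u. f u - g u) = (\<lambda>u. nmu rk q f u - nmu rk q g u)"
  using nmu_add[OF assms(1) fins_smul[OF assms(2), of "-1"]] nmu_smul[OF assms(2), of "-1"] by simp

lemma cmap_smul_delta: 
  "cmap rk q (Suc (length l)) (\<lambda>u. s * delta (l @ x # y # r) u)
    = (\<lambda>u. s * q x y * delta (l @ rk x y # x # r) u)"
  unfolding cmap_def lin_smul_delta braidw_at by (simp add: mult.assoc)

lemmas cmap1 = cmap_smul_delta[of "[]", simplified]
lemmas cmap2 = cmap_smul_delta[of "[x]" for x, simplified]
lemmas cmap3 = cmap_smul_delta[of "[x, y]" for x y, simplified]

lemma omegaw_pair:
  assumes "x \<in> X" "y \<in> X"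
  shows "om [x, y] = (\<lambda>u. delta [x, y] u + q x y * delta [rk x y, x] u)"
  using qsh_letter_delta[of x "[y]"] assms
  by (simp add: omegaw_Cons[of x "[y]"] omegaw_single qw_def)

lemma slim_commuting:
  assumes "x \<in> X" "y \<in> X" "rk x y = y" "x \<noteq> y"
  shows "om [x, y] = (\<lambda>u. q x y * om [y, x] u)"
proof -
  have c: "cmap rk q 1 (delta [x, y]) = (\<lambda>u. q x y * delta [y, x] u)"
    using cmap1[of 1 x y "[]"] assms(3) by simp
  have "nmu rk q (\<lambda>u. delta [x, y] u - cmap rk q 1 (delta [x, y]) u) = (\<lambda>u. 0)"
    by (rule conjunct1[OF slim[unfolded slim2_def], rule_format]) (use assms in auto)
  then have "nmu rk q (\<lambda>u. delta [x, y] u - q x y * delta [y, x] u) = (\<lambda>u. 0)"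
    unfolding c .
  moreover have "nmu rk q (\<lambda>u. delta [x, y] u - q x y * delta [y, x] u)
      = (\<lambda>u. om [x, y] u - q x y * om [y, x] u)"
    using assms by (simp add: nmu_diff nmu_smul nmu_delta fins_delta fins_smul)
  ultimately have eq: "(\<lambda>u. om [x, y] u - q x y * om [y, x] u) = (\<lambda>u. 0)" by simp
  show ?thesis using fun_cong[OF eq] by auto
qed

text \<open>Comparing coefficients of the word \<open>x y\<close> in the quadratic relation turns it
  into a condition on the cocycle.\<close>

lemma q_commuting:
  assumes "x \<in> X" "y \<in> X" "rk x y = y" "x \<noteq> y"
  shows "q x y * q y x = 1"
proof -
  have "om [x, y] [x, y] = q x y * om [y, x] [x, y]"
    using fun_cong[OF slim_commuting[OF assms]] .
  then show ?thesis
    using assms rk_comm[of x y] by (simp add: omegaw_pair delta_def)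
qed

lemma slim_braided:
  assumes "x \<in> X" "y \<in> X" "rk x y \<noteq> y"
  shows "om [x, y] = (\<lambda>u. q x y * om [rk x y, x] u - q x y * q (rk x y) x * om [y, rk x y] u)"
proof -
  have s: "rk x y \<in> X" using assms rk_closed by simp
  have c: "cmap rk q 1 (delta [x, y]) = (\<lambda>u. q x y * delta [rk x y, x] u)"
    using cmap1[of 1 x y "[]"] by simp
  have c2: "cmap rk q 1 (\<lambda>u. q x y * delta [rk x y, x] u)
      = (\<lambda>u. q x y * q (rk x y) x * delta [y, rk x y] u)"
    using cmap1[of "q x y" "rk x y" x "[]"] braid_triple[OF assms] by simp
  have "nmu rk q (\<lambda>u. delta [x, y] u - cmap rk q 1 (delta [x, y]) u
      + cmap rk q 1 (cmap rk q 1 (delta [x, y])) u) = (\<lambda>u. 0)"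
    by (rule conjunct2[OF slim[unfolded slim2_def], rule_format]) (use assms in auto)
  then have "nmu rk q (\<lambda>u. delta [x, y] u - q x y * delta [rk x y, x] u
      + q x y * q (rk x y) x * delta [y, rk x y] u) = (\<lambda>u. 0)"
    unfolding c c2 .
  moreover have "fins X (\<lambda>u. delta [x, y] u - q x y * delta [rk x y, x] u)"
    using fins_add[OF fins_delta fins_smul[OF fins_delta], of "[x, y]" X "[rk x y, x]" "- q x y"]
      assms s by simp
  then have "nmu rk q (\<lambda>u. delta [x, y] u - q x y * delta [rk x y, x] u
      + q x y * q (rk x y) x * delta [y, rk x y] u)
    = (\<lambda>u. om [x, y] u - q x y * om [rk x y, x] u + q x y * q (rk x y) x * om [y, rk x y] u)"
    using assms s by (simp add: nmu_add nmu_diff nmu_smul nmu_delta fins_delta fins_smul)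
  ultimately have "om [x, y] u - q x y * om [rk x y, x] u + q x y * q (rk x y) x * om [y, rk x y] u = 0" for u
    by (simp add: fun_eq_iff)
  then show ?thesis by (auto simp: algebra_simps add_eq_0_iff)
qed

text \<open>The word \<open>x y\<close> has coefficient 1 on the left of the relation; on the right
  it occurs only in the symmetrization of \<open>y (rk x y)\<close>. This is the source of the signs
  below.\<close>

lemma q_braided:
  assumes "x \<in> X" "y \<in> X" "rk x y \<noteq> y"
  shows "q x y * q (rk x y) x * q y (rk x y) = -1"
proof -
  have s: "rk x y \<in> X" using assms rk_closed by simp
  have ne: "x \<noteq> y" "rk x y \<noteq> x" 
    using assms rk_idem rk_comm[of x x] rk_inj[of x y x] by metis+
  have "om [x, y] [x, y] = q x y * om [rk x y, x] [x, y] - q x y * q (rk x y) x * om [y, rk x y] [x, y]"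
    using fun_cong[OF slim_braided[OF assms]] .
  then have "1 = - (q x y * q (rk x y) x * q y (rk x y))"
    using assms s ne braid_triple[OF assms] by (simp add: omegaw_pair delta_def)
  then show ?thesis by (metis minus_minus)
qed

lemma omegaw_context:
  assumes "set l \<subseteq> X" "set m \<subseteq> X" "set r \<subseteq> X"
  shows "om (l @ m @ r) = qsh (om l) (qsh (om m) (om r))"
  using assms by (simp add: omegaw_append)

lemma slim_commuting_context:
  assumes "x \<in> X" "y \<in> X" "rk x y = y" "x \<noteq> y" "set l \<subseteq> X" "set r \<subseteq> X"
  shows "om (l @ x # y # r) u = q x y * om (l @ y # x # r) u"
proof -
  have "om (l @ [x, y] @ r) = qsh (om l) (qsh (om [x, y]) (om r))"
    by (rule omegaw_context) (use assms in auto)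
  also have "\<dots> = (\<lambda>u. q x y * qsh (om l) (qsh (om [y, x]) (om r)) u)"
    unfolding slim_commuting[OF assms(1-4)] qsh_smul_left qsh_smul_right ..
  also have "qsh (om l) (qsh (om [y, x]) (om r)) = om (l @ [y, x] @ r)"
    by (rule omegaw_context[symmetric]) (use assms in auto)
  finally show ?thesis by simp
qed

lemma slim_braided_context:
  assumes "x \<in> X" "y \<in> X" "rk x y \<noteq> y" "set l \<subseteq> X" "set r \<subseteq> X"
  shows "om (l @ x # y # r) u =
    q x y * om (l @ rk x y # x # r) u - q x y * q (rk x y) x * om (l @ y # rk x y # r) u"
proof -
  have s: "rk x y \<in> X" using assms rk_closed by simp
  have "om (l @ [x, y] @ r) = qsh (om l) (qsh (om [x, y]) (om r))"
    by (rule omegaw_context) (use assms in auto)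
  also have "om [x, y] = (\<lambda>u. q x y * om [rk x y, x] u + (- q x y * q (rk x y) x) * om [y, rk x y] u)"
    using slim_braided[OF assms(1-3)] by simp
  also have "qsh (om l) (qsh (\<lambda>u. q x y * om [rk x y, x] u + (- q x y * q (rk x y) x) * om [y, rk x y] u) (om r))
      = (\<lambda>u. q x y * qsh (om l) (qsh (om [rk x y, x]) (om r)) u
        + (- q x y * q (rk x y) x) * qsh (om l) (qsh (om [y, rk x y]) (om r)) u)"
    unfolding qsh_add_left qsh_smul_left qsh_add_right qsh_smul_right ..
  also have "qsh (om l) (qsh (om [rk x y, x]) (om r)) = om (l @ [rk x y, x] @ r)"
    by (rule omegaw_context[symmetric]) (use assms s in auto)
  also have "qsh (om l) (qsh (om [y, rk x y]) (om r)) = om (l @ [y, rk x y] @ r)"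
    by (rule omegaw_context[symmetric]) (use assms s in auto)
  finally show ?thesis by simp
qed

lemma lder_omegaw4:
  assumes "x1 \<in> X" "x2 \<in> X" "x3 \<in> X" "x4 \<in> X" "Y \<in> X"
  shows "lder Y (om [x1, x2, x3, x4]) u =
      of_bool (x1 = Y) * om [x2, x3, x4] u
    + of_bool (rk x1 x2 = Y) * q x1 x2 * om [x1, x3, x4] u
    + of_bool (rk x1 (rk x2 x3) = Y) * (q x1 (rk x2 x3) * q x2 x3) * om [x1, x2, x4] u
    + of_bool (rk x1 (rk x2 (rk x3 x4)) = Y) * qd [x1, x2, x3] x4 * om [x1, x2, x3] u"
  using lder_omegaw[of "[x1, x2, x3, x4]" Y] assms
  by (simp add: lessThan_Suc numeral_eq_Suc algebra_simps)

end

section \<open>Rack identities for the quadruple\<close>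

locale slim_quadruple = slim_rack +
  fixes a b c d e f g
  assumes abcd: "a \<in> X" "b \<in> X" "c \<in> X" "d \<in> X"
    and dist: "a \<noteq> b" "a \<noteq> c" "a \<noteq> d" "b \<noteq> c" "b \<noteq> d" "c \<noteq> d"
    and noncomm: "rk a b \<noteq> b" "rk a d \<noteq> d" "rk b c \<noteq> c" "rk b d \<noteq> d" "rk c d \<noteq> d"
    and ac: "rk a c = c"
    and h1: "rk b (rk c d) = rk c d" "rk c d \<noteq> b"
    and h2: "rk a (rk b d) = rk b d" "rk b d \<noteq> a"
    and e_eq: "e = rk a (rk b (rk c d))"
    and f_eq: "f = rk e (rk a (rk b c))"
    and g_eq: "g = rk f (rk e (rk a b))"
begin

text \<open>Under the hypotheses \<open>a\<close>, \<open>b\<close>, \<open>c\<close>, \<open>d\<close> satisfy the relations of the Artin group of type D4.\<close>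

definition w where "w = rk c d"
definition u where "u = rk b c"
definition y where "y = rk a b"
definition z where "z = rk a u"

lemma wuyz_X: "w \<in> X" "u \<in> X" "y \<in> X" "z \<in> X"
  using abcd by (auto simp: w_def u_def y_def z_def rk_closed)

lemma efg_X: "e \<in> X" "f \<in> X" "g \<in> X"
  using abcd by (auto simp: e_eq f_eq g_eq rk_closed)

lemmas allX = abcd wuyz_X efg_X

lemma cd: "rk c d = w" and bc: "rk b c = u" and ab: "rk a b = y" and au: "rk a u = z"
  by (simp_all add: w_def u_def y_def z_def)

lemma bw: "rk b w = w"
  using h1(1) cd by simp

lemma e_aw: "rk a w = e"
  by (simp add: e_eq cd bw)

lemma wb: "rk w b = b"
  by (rule rk_comm[OF _ _ bw]) (simp_all add: allX)

lemma ca: "rk c a = a"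
  by (rule rk_comm[OF _ _ ac]) (simp_all add: allX)

lemma w_ne: "w \<noteq> b" "w \<noteq> d" "w \<noteq> c"
proof -
  show "w \<noteq> b" "w \<noteq> d" using h1(2) noncomm(5) cd by auto
  show "w \<noteq> c" using rk_inj[of c d c] rk_idem[of c] dist cd allX by auto
qed

lemma cd_triple: "rk w c = d" "rk d w = c"
  using braid_triple[of c d] noncomm allX w_def by auto

lemma bc_triple: "rk u b = c" "rk c u = b"
  using braid_triple[of b c] noncomm allX u_def by auto

lemma ab_triple: "rk y a = b" "rk b y = a"
  using braid_triple[of a b] noncomm allX y_def by auto

lemma wu: "rk w u = rk b d"
  using rk_dist[of w b c] wb cd_triple allX bc by auto

text \<open>Both \<open>e\<close> and \<open>z\<close> are images under \<open>rk a\<close>, so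
  \<open>f\<close> is the image of \<open>rk w u = rk b d\<close>, and this is fixed by
  \<open>a\<close>.\<close>

lemma f_bd: "rk b d = f"
  using rk_dist[of a w u] e_aw au wu h2 f_eq allX z_def u_def by auto

lemma af: "rk a f = f" and fa: "rk f a = a" and fa_ne: "f \<noteq> a"
  using h2 f_bd rk_comm[of a f] allX by auto

lemma bd_triple: "rk f b = d" "rk d f = b"
  using braid_triple[of b d] noncomm allX f_bd by auto

lemma ez: "rk e z = f"
  by (simp add: f_eq z_def u_def)

lemma ey: "rk e y = y"
  using rk_dist[of a w b] wb e_aw ab allX by simp

lemma fy: "rk f y = g"
  using g_eq ey ab by simp

text \<open>Apply \<open>rk a\<close> to \<open>rk f b = d\<close>: since \<open>a\<close> fixes
  \<open>f\<close> and sends \<open>b\<close> to \<open>y\<close>, the result is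
  \<open>rk f y = g\<close>.\<close>

lemma g_ad: "rk a d = g"
  using rk_dist[of a f b] af ab bd_triple fy allX by simp

lemma ad_triple: "rk g a = d" "rk d g = a"
  using braid_triple[of a d] noncomm allX g_ad by auto

lemma cg: "rk c g = e"
  using rk_dist[of c a d] ca g_ad e_aw cd allX by simp

lemma g_ne_e: "g \<noteq> e"
  using rk_inj[of a d w] e_aw g_ad w_ne allX by auto

lemma cg_triple: "rk e c = g" "rk g e = c"
  using braid_triple[of c g] cg g_ne_e allX by auto

lemma w_ne_e: "w \<noteq> e"
proof
  assume "w = e"
  then have "rk c d = rk c g" using cd cg by simp
  then show False using rk_inj[of c d g] noncomm g_ad allX by auto
qed

text \<open>Applying \<open>rk c\<close> to both sides turns the claim into
  \<open>rk w b = b\<close>.\<close>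

lemma du: "rk d u = u"
proof -
  have "rk c (rk d u) = rk c u" using rk_dist[of c d u] cd bc_triple wb allX by simp
  then show ?thesis using rk_inj[of c "rk d u" u] allX rk_closed by auto
qed

lemma dy: "rk d y = y" and yd: "rk y d = d"
proof -
  have "rk b (rk d y) = rk b y" using rk_dist[of b d y] f_bd ab_triple fa allX by simp
  then show "rk d y = y" using rk_inj[of b "rk d y" y] allX rk_closed by auto
  then show "rk y d = d" using rk_comm[of d y] allX by auto
qed

lemma u_ne_f: "u \<noteq> f"
  using rk_inj[of b c d] bc f_bd dist allX by auto

lemma z_ne_f: "z \<noteq> f"
  using rk_inj[of a u f] au af u_ne_f allX by auto

lemma ez_triple: "rk f e = z" "rk z f = e"
  using braid_triple[of e z] ez z_ne_f allX by auto

lemma y_ne_g: "y \<noteq> g"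
  using rk_inj[of a b d] ab g_ad dist allX by auto

lemma fy_triple: "rk g f = y" "rk y g = f"
  using braid_triple[of f y] fy y_ne_g allX by auto

lemma yc: "rk y c = z"
  using rk_dist[of a b c] ab bc au ac allX by simp

lemma u_ne_c: "u \<noteq> c"
  using noncomm bc by simp

lemma z_ne_c: "z \<noteq> c"
  using rk_inj[of a u c] au ac u_ne_c allX by auto

lemma gz: "rk g z = z"
  using rk_dist[of a d u] g_ad du au allX by simp

lemma uf: "rk u f = w"
  using rk_dist[of b c d] bc f_bd cd bw allX by simp

lemma comm_ne: "a \<noteq> f" "b \<noteq> w"
  using fa_ne w_ne by auto

section \<open>Scalar identities for the cocycle\<close>

lemma q_cg: "q c g * q a d = q a w * q c d"
  using cocyc[of a c d] ac g_ad cd allX by simp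

lemma q_ey: "q e y = q w b"
  using q_comm_invariant[of a w b] e_aw ab wb allX by simp

lemma q_bw: "q b w * q w b = 1"
  using q_commuting[of b w] bw comm_ne allX by simp

lemma q_yc: "q y c * q a c = q a u * q b c"
  using cocyc[of a b c] ab ac bc allX by simp

lemma q_fy: "q f y * q g f * q y g = -1"
  using q_braided[of f y] fy y_ne_g allX by simp

lemma q_yg: "q y g * q e c = q e z * q y c"
  using cocyc[of e y c] ey cg_triple yc allX by simp

lemma q_ez: "q e z * q f e * q z f = -1"
  using q_braided[of e z] ez z_ne_f allX by simp

lemma q_uf: "q u f * q b d = q b w * q c d"
  using cocyc[of b c d] bc f_bd cd allX by simp

lemma q_zf: "q z f * q a f = q a w * q u f"
  using cocyc[of a u f] au af uf allX by simp

lemma q_fyab: "q f y * q a b = q a d * q f b"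
  using cocyc[of a f b] af ab bd_triple allX by simp

lemma q_gz: "q g z = q d u"
  using q_comm_invariant[of a d u] g_ad au du allX by simp

text \<open>The commuting pair \<open>(rk d b, c)\<close> links both sides: \<open>b\<close> carries
  it to \<open>(d, u)\<close>, and \<open>d\<close> carries \<open>(b, w)\<close> to it. The cocycle
  is constant along such moves of commuting pairs.\<close>

lemma q_du: "q d u = q b w"
proof -
  have db: "rk d b \<in> X" using allX rk_closed by simp
  have "rk (rk d b) c = c" using rk_dist[of d b w] bw cd_triple allX by simp
  moreover have "rk b (rk d b) = d" using rk_braid[of b d] noncomm allX by simp
  ultimately have "q d u = q (rk d b) c" using q_comm_invariant[of b "rk d b" c] bc db allX by simp
  also have "\<dots> = q b w" using q_comm_invariant[of d b w] bw cd_triple allX by simp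
  finally show ?thesis .
qed

text \<open>The scalars collected by one, two and three applications of \<open>P\<close> to
  \<open>a b c d\<close>.\<close>

definition k1 where "k1 = qd [a, b, c] d"
definition k2 where "k2 = k1 * qd [e, a, b] c"
definition k3 where "k3 = k2 * qd [f, e, a] b"

lemma k1_eq: "k1 = q a w * q b w * q c d"
  by (simp add: k1_def cd bw)

lemma k2_eq: "k2 = k1 * (q e z * q a u * q b c)"
  by (simp add: k2_def bc au)

lemma k3_eq: "k3 = k2 * (q f y * q e y * q a b)"
  by (simp add: k3_def ab ey)

lemma k1_y: "k1 * q e y = q a d * q c g"
proof -
  have "k1 * q e y = (q a w * q c d) * (q b w * q w b)" unfolding k1_eq q_ey by (simp add: algebra_simps)
  then show ?thesis unfolding q_bw q_cg[symmetric] by (simp add: algebra_simps)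
qed

text \<open>The coefficient needed to cancel \<open>g e a\<close>. Cocycle identities trade factors
  until the braided triple for \<open>f\<close>, \<open>y\<close> appears, and its value -1 gives
  the sign.\<close>

lemma k3_y: "k3 * q g f = - (q a b * q a c * q a d * q c g * q e c)"
proof -
  have "k3 * q g f = (k1 * q e y) * (q a u * q b c) * q e z * q a b * (q f y * q g f)"
    unfolding k3_eq k2_eq by (simp add: algebra_simps)
  also have "\<dots> = q a d * q c g * q a c * q a b * (q e z * q y c) * (q f y * q g f)"
    unfolding k1_y q_yc[symmetric] by (simp add: algebra_simps)
  also have "\<dots> = q a d * q c g * q a c * q a b * q e c * (q f y * q g f * q y g)"
    unfolding q_yg[symmetric] by (simp add: algebra_simps)
  finally show ?thesis unfolding q_fy by (simp add: algebra_simps)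
qed

text \<open>The coefficient needed to cancel \<open>f a b\<close>; the sign comes from the braided
  triple for \<open>e\<close>, \<open>z\<close>.\<close>

lemma k2_z: "k2 * q f e = - (q a u * q b c * q b d * q a f)"
proof -
  have "k2 * q f e = (q b w * q c d) * q a w * (q e z * q f e) * q a u * q b c"
    unfolding k2_eq k1_eq by (simp add: algebra_simps)
  also have "\<dots> = q b d * (q a w * q u f) * (q e z * q f e) * q a u * q b c"
    unfolding q_uf[symmetric] by (simp add: algebra_simps)
  also have "\<dots> = q b d * q a f * (q e z * q f e * q z f) * q a u * q b c"
    unfolding q_zf[symmetric] by (simp add: algebra_simps)
  finally show ?thesis unfolding q_ez by (simp add: algebra_simps)
qed

lemma k3_z: "k3 * (q g z * q f e) = - (q a u * q b c * q b d * q f b * q a d * q a f)"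
proof -
  have "k3 * (q g z * q f e) = (k2 * q f e) * (q f y * q a b) * (q b w * q w b)"
    unfolding k3_eq q_ey q_gz q_du by (simp add: algebra_simps)
  then show ?thesis unfolding k2_z q_fyab q_bw by (simp add: algebra_simps)
qed

text \<open>Chosen so that, in the derivative at \<open>y\<close>, the words \<open>e a c\<close>
  and \<open>g e a\<close> occur with the coefficients that \<open>Z\<close> supplies with opposite
  sign, leaving a single word free of \<open>a\<close>. The word \<open>c g a\<close> is eliminated
  by rewriting \<open>c g\<close>.\<close>

lemma acd:
  "om [a, c, d] t = q a d * q c g * om [e, a, c] t
    - q a c * q a d * q c g * q e c * om [g, e, a] t - q a c * q a d * q g a * om [c, d, g] t"
proof -
  have r1: "om [a, c, d] t = q a c * om [c, a, d] t"
    using slim_commuting_context[of a c "[]" "[d]"] ac dist allX by simp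
  have r2: "om [c, a, d] t = q a d * om [c, g, a] t - q a d * q g a * om [c, d, g] t"
    using slim_braided_context[of a d "[c]" "[]"] g_ad noncomm allX by simp
  have r3: "om [c, g, a] t = q c g * om [e, c, a] t - q c g * q e c * om [g, e, a] t"
    using slim_braided_context[of c g "[]" "[a]"] cg g_ne_e allX by simp
  have r4: "om [e, a, c] t = q a c * om [e, c, a] t"
    using slim_commuting_context[of a c "[e]" "[]"] ac dist allX by simp
  show ?thesis unfolding r1 r2 r3 r4 by (simp add: algebra_simps)
qed

lemma abd:
  "om [a, b, d] t = q b d * q a f * om [f, a, b] t
    - q b d * q f b * q a d * q a f * om [g, f, a] t + q b d * q f b * q a d * q g a * om [d, g, f] t"
proof -
  have r1: "om [a, b, d] t = q b d * om [a, f, b] t - q b d * q f b * om [a, d, f] t"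
    using slim_braided_context[of b d "[a]" "[]"] f_bd noncomm allX by simp
  have r2: "om [a, f, b] t = q a f * om [f, a, b] t"
    using slim_commuting_context[of a f "[]" "[b]"] af comm_ne allX by simp
  have r3: "om [a, d, f] t = q a d * om [g, a, f] t - q a d * q g a * om [d, g, f] t"
    using slim_braided_context[of a d "[]" "[f]"] g_ad noncomm allX by simp
  have r4: "om [g, a, f] t = q a f * om [g, f, a] t"
    using slim_commuting_context[of a f "[g]" "[]"] af comm_ne allX by simp
  show ?thesis unfolding r1 r2 r3 r4 by (simp add: algebra_simps)
qed

lemma qd_rotations: "qd [a, b, c] d = k1" "k1 * qd [e, a, b] c = k2" "k2 * qd [f, e, a] b = k3"
  by (simp_all only: k1_def k2_def k3_def)

definition Z where
  "Z = (\<lambda>t. om [a, b, c, d] t - k1 * om [e, a, b, c] t + k2 * om [f, e, a, b] t - k3 * om [g, f, e, a] t)"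

lemma Ztens_eq: "Ztens rk q a b c d = (\<lambda>t. delta [a, b, c, d] t - k1 * delta [e, a, b, c] t
    + k2 * delta [f, e, a, b] t - k3 * delta [g, f, e, a] t)"
proof -
  define P where "P = cmap rk q 1 \<circ> cmap rk q 2 \<circ> cmap rk q 3"
  \<comment> \<open>Applying the crossings from right to left carries the last letter to the front
    through the other three.\<close>
  have P: "P (\<lambda>t. s * delta [x1, x2, x3, x4] t)
      = (\<lambda>t. s * qd [x1, x2, x3] x4 * delta [rk x1 (rk x2 (rk x3 x4)), x1, x2, x3] t)" for s x1 x2 x3 x4
    by (simp add: P_def numeral_2_eq_2 numeral_3_eq_3 cmap1 cmap2 cmap3)
      (simp add: mult.assoc mult.left_commute mult.commute)
  have 1: "P (delta [a, b, c, d]) = (\<lambda>t. k1 * delta [e, a, b, c] t)"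
    using P[of 1 a b c d] e_eq by (simp add: k1_def)
  have 2: "P (\<lambda>t. k1 * delta [e, a, b, c] t) = (\<lambda>t. k2 * delta [f, e, a, b] t)"
    using P[of k1 e a b c] f_eq by (simp add: k2_def)
  have 3: "P (\<lambda>t. k2 * delta [f, e, a, b] t) = (\<lambda>t. k3 * delta [g, f, e, a] t)"
    using P[of k2 f e a b] g_eq by (simp add: k3_def)
  show ?thesis
    unfolding Ztens_def Let_def P_def[symmetric] by (simp add: numeral_2_eq_2 numeral_3_eq_3 1 2 3)
qed

lemma fins_Ztens: "fins X (Ztens rk q a b c d)" and nmu_Ztens: "nmu rk q (Ztens rk q a b c d) = Z"
proof -
  define s where "s i = [1, - k1, k2, - k3] ! i" for i
  define v where "v i = [[a, b, c, d], [e, a, b, c], [f, e, a, b], [g, f, e, a]] ! i" for i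
  have eq: "Ztens rk q a b c d = (\<lambda>t. \<Sum>i<4. s i * delta (v i) t)"
    by (simp add: Ztens_eq s_def v_def numeral_eq_Suc)
  have "set (v i) \<subseteq> X" if "i < 4" for i
    using that allX by (auto simp: v_def numeral_eq_Suc less_Suc_eq)
  then show "fins X (Ztens rk q a b c d)" unfolding eq by (intro fins_sum fins_delta) auto
  have "nmu rk q (Ztens rk q a b c d) = (\<lambda>t. \<Sum>i<4. s i * om (v i) t)"
    unfolding eq by (rule nmu_sum_delta) simp
  then show "nmu rk q (Ztens rk q a b c d) = Z"
    by (simp add: Z_def s_def v_def numeral_eq_Suc)
qed

lemma lder_Z:
  assumes "Y \<in> X"
  shows "lder Y Z t = of_bool (a = Y) * om [b, c, d] t
    + of_bool (rk e a = Y) * (- (k1 * q e a)) * om [e, b, c] t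
    + of_bool (rk f (rk e a) = Y) * (k2 * (q f (rk e a) * q e a)) * om [f, e, b] t
    + of_bool (rk g (rk f (rk e a)) = Y) * (- (k3 * qd [g, f, e] a)) * om [g, f, e] t
    + of_bool (y = Y) * (- (q a b * q a c * q a d * q g a)) * om [c, d, g] t
    + of_bool (z = Y) * (q a u * q b c * q b d * q f b * q a d * q g a) * om [d, g, f] t"
proof -
  have "lder Y Z t = lder Y (om [a, b, c, d]) t - k1 * lder Y (om [e, a, b, c]) t
      + k2 * lder Y (om [f, e, a, b]) t - k3 * lder Y (om [g, f, e, a]) t"
    by (simp add: Z_def lder_def)
  \<comment> \<open>Summands are sorted by index. In the last three, deleting the last letter of one
    word and the first letter of its rotation gives the same word, and the coefficients vanish by
    the choice of \<open>k1\<close>, \<open>k2\<close>, \<open>k3\<close>.\<close>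
  also have "\<dots> = of_bool (a = Y) * om [b, c, d] t
    + of_bool (rk e a = Y) * (- (k1 * q e a)) * om [e, b, c] t
    + of_bool (rk f (rk e a) = Y) * (k2 * (q f (rk e a) * q e a)) * om [f, e, b] t
    + of_bool (rk g (rk f (rk e a)) = Y) * (- (k3 * qd [g, f, e] a)) * om [g, f, e] t
    + of_bool (y = Y) * (q a b * om [a, c, d] t - (k1 * q e y) * q a b * om [e, a, c] t
        - (k3 * q g f) * om [g, e, a] t)
    + of_bool (z = Y) * (q a u * q b c * om [a, b, d] t + (k2 * q f e) * om [f, a, b] t
        - (k3 * (q g z * q f e)) * om [g, f, a] t)
    + of_bool (e = Y) * (qd [a, b, c] d - k1) * om [a, b, c] t
    + of_bool (f = Y) * (k2 - k1 * qd [e, a, b] c) * om [e, a, b] t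
    + of_bool (g = Y) * (k2 * qd [f, e, a] b - k3) * om [f, e, a] t"
    using assms allX
    by (simp add: lder_omegaw4 ab bc cd bw au e_aw ey ez ez_triple fy fy_triple gz algebra_simps
        del: qd.simps)
  finally show ?thesis
    unfolding qd_rotations k1_y k3_y k2_z k3_z acd abd by (simp add: algebra_simps del: qd.simps)
qed

end

section \<open>Right derivatives of symmetrized words\<close>

context rack_cocycle
begin

lemma rder_omegaw:
  assumes "set w \<subseteq> X"
  shows "rder y (om w) = (\<lambda>u. \<Sum>i<length w. (if w ! i = y then qw y (drop (Suc i) w) else 0)
    * om (take i w @ map (rk y) (drop (Suc i) w)) u)"
proof (cases "y \<in> X")
  case False
  then have "w ! i \<noteq> y" if "i < length w" for i using assms that nth_mem by blast
  then show ?thesis using rder_notin[OF omegaw_supX[OF assms] False] by simp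
next
  case y: True
  show ?thesis
    using assms
  proof (induction w)
    case Nil
    show ?case by (simp add: rder_delta_nil)
  next
    case (Cons x w)
    have x: "x \<in> X" and w: "set w \<subseteq> X" using Cons.prems by auto
    let ?cf = "\<lambda>w i. (if w ! i = y then qw y (drop (Suc i) w) else 0)"
    have X: "set (take i w @ map (rk y) (drop (Suc i) w)) \<subseteq> X" for i
      using w y rk_closed set_take_subset[of i w] set_drop_subset[of "Suc i" w] by auto
    have "rder y (om (x # w)) = (\<lambda>u. (if x = y then qw y w else 0) * om (map (rk y) w) u
        + (\<Sum>i<length w. ?cf w i * qsh (delta [x]) (om (take i w @ map (rk y) (drop (Suc i) w))) u))"
      unfolding rder_omegaw_Cons[OF x w] Cons.IH[OF w] qsh_sum_right[OF finite_lessThan]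
      using act_omegaw[OF y w] by auto
    also have "\<dots> = (\<lambda>u. (if x = y then qw y w else 0) * om (map (rk y) w) u
        + (\<Sum>i<length w. ?cf (x # w) (Suc i)
          * om (take (Suc i) (x # w) @ map (rk y) (drop (Suc (Suc i)) (x # w))) u))"
      using omegaw_Cons[OF x X] by (simp cong: if_cong)
    also have "\<dots> = (\<lambda>u. \<Sum>i<length (x # w). ?cf (x # w) i
        * om (take i (x # w) @ map (rk y) (drop (Suc i) (x # w))) u)"
      by (simp only: length_Cons sum.lessThan_Suc_shift) simp
    finally show ?case .
  qed
qed

text \<open>A braiding that ends in \<open>y\<close> is undone by choosing the occurrence of
  \<open>y\<close> that was carried to the end and letting it act on the letters it passed.
  Iterating this bounds the words that can contribute to \<open>a b c d\<close>.\<close>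

lemma omegaw_snoc_nonzero:
  assumes "set w \<subseteq> X" "om w (v @ [y]) \<noteq> 0"
  shows "\<exists>w1 w2. w = w1 @ y # w2 \<and> om (w1 @ map (rk y) w2) v \<noteq> 0"
proof -
  have "rder y (om w) v \<noteq> 0" using assms(2) by (simp add: rder_def)
  then have "(\<Sum>i<length w. (if w ! i = y then qw y (drop (Suc i) w) else 0)
    * om (take i w @ map (rk y) (drop (Suc i) w)) v) \<noteq> 0"
    unfolding rder_omegaw[OF assms(1)] .
  then obtain i where i: "i \<in> {..<length w}" "(if w ! i = y then qw y (drop (Suc i) w) else 0)
    * om (take i w @ map (rk y) (drop (Suc i) w)) v \<noteq> 0"
    by (rule sum.not_neutral_contains_not_neutral)
  then have "w ! i = y" "om (take i w @ map (rk y) (drop (Suc i) w)) v \<noteq> 0"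
    by (auto split: if_splits)
  then show ?thesis
    using i(1) id_take_nth_drop[of i w] by (intro exI[of _ "take i w"] exI[of _ "drop (Suc i) w"]) auto
qed

lemma omegaw_snoc_same:
  assumes "set w \<subseteq> X" "y \<in> X" "y \<notin> set w"
  shows "om (w @ [y]) (v @ [y]) = om w v"
proof -
  have "om (w @ [y]) (v @ [y]) = rder y (om (w @ [y])) v" by (simp add: rder_def)
  also have "\<dots> = (\<Sum>i<length w. (if w ! i = y then qw y (drop (Suc i) w @ [y]) else 0)
      * om (take i w @ map (rk y) (drop (Suc i) w @ [y])) v) + om w v"
    using assms by (subst rder_omegaw) (auto simp: nth_append qw_def intro!: sum.cong)
  also have "(\<Sum>i<length w. (if w ! i = y then qw y (drop (Suc i) w @ [y]) else 0)
      * om (take i w @ map (rk y) (drop (Suc i) w @ [y])) v) = 0"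
    using assms(3) nth_mem[of _ w] by (intro sum.neutral) auto
  finally show ?thesis by simp
qed

end

section \<open>The subalgebra generated by \<open>Z\<close> and the letters\<close>

context slim_quadruple
begin

definition letters where "letters = {b, c, d, e, f, g}"

definition gens where "gens = {Ztens rk q a b c d, delta [b], delta [c], delta [d], delta [e], delta [f], delta [g]}"

lemma gens_eq: "gens = insert (Ztens rk q a b c d) ((\<lambda>x. delta [x]) ` letters)"
  by (simp add: gens_def letters_def)

lemma letters_X: "letters \<subseteq> X"
  using allX by (auto simp: letters_def)

lemma Z_homg: "Z \<in> spanK (homg [a, b, c, d])"
proof -
  have r1: "req [e, a, b, c] [a, b, c, d]"
    using req_rotate[of "[a, b, c]" d] allX e_eq by simp
  have "req [f, e, a, b] [e, a, b, c]"
    using req_rotate[of "[e, a, b]" c] allX f_eq by simp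
  then have r2: "req [f, e, a, b] [a, b, c, d]" using r1 req_trans by blast
  have "req [g, f, e, a] [f, e, a, b]"
    using req_rotate[of "[f, e, a]" b] allX g_eq by simp
  then have r3: "req [g, f, e, a] [a, b, c, d]" using r2 req_trans by blast
  have mem: "om v \<in> spanK (homg [a, b, c, d])" if "set v \<subseteq> X" "req v [a, b, c, d]" for v
    unfolding homg_def by (intro spanK_base CollectI exI[of _ v]) (use that in simp)
  have "(\<lambda>t. om [a, b, c, d] t + (- k1) * om [e, a, b, c] t + k2 * om [f, e, a, b] t
      + (- k3) * om [g, f, e, a] t) \<in> spanK (homg [a, b, c, d])"
    by (intro spanK_add spanK_smul mem) (use allX r1 r2 r3 req_refl in auto)
  then show ?thesis by (simp add: Z_def)
qed

lemma gens_fins: "s \<in> gens \<Longrightarrow> fins X s"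
  using fins_Ztens letters_X by (auto simp: gens_eq intro!: fins_delta)

lemma gens_homg: "s \<in> gens \<Longrightarrow> \<exists>w. set w \<subseteq> X \<and> nmu rk q s \<in> spanK (homg w)"
proof -
  assume "s \<in> gens"
  then consider "s = Ztens rk q a b c d" | x where "x \<in> letters" "s = delta [x]"
    by (auto simp: gens_eq)
  then show ?thesis
  proof cases
    case 1
    then show ?thesis using Z_homg nmu_Ztens allX by (intro exI[of _ "[a, b, c, d]"]) simp
  next
    case 2
    then have "om [x] \<in> homg [x]"
      unfolding homg_def using letters_X by (intro CollectI exI[of _ "[x]"]) (auto simp: req_refl)
    then show ?thesis
      using 2 letters_X by (intro exI[of _ "[x]"]) (auto simp: nmu_delta intro: spanK_base)
  qed
qed

lemma omegaw_letters: "set v \<subseteq> letters \<Longrightarrow> om v \<in> gensub gens"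
proof (induction v)
  case Nil
  show ?case
    using nmu_tensl_gensub[where S = gens and ws = "[]", OF gens_fins gens_homg]
      nmu_tensl_Nil[where S = gens, OF gens_fins gens_homg] by simp
next
  case (Cons x v)
  then have "delta [x] \<in> gens" "x \<in> X" "set v \<subseteq> X" using letters_X by (auto simp: gens_eq)
  moreover from this have "om (x # v) = qsh (nmu rk q (delta [x])) (om v)"
    by (simp add: nmu_delta omegaw_Cons qsh_one_right)
  moreover have "om v \<in> gensub gens" using Cons by simp
  ultimately show ?case
    using gensub_qsh[OF gens_fins gens_homg nmu_gensub[where S = gens, OF gens_fins gens_homg]] by simp
qed

text \<open>The six words surviving in \<open>lder_Z\<close> avoid \<open>a\<close> and are products
  of generating letters.\<close>

lemma gens_lder:
  assumes "s \<in> gens" "Y \<in> X"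
  shows "lder Y (nmu rk q s) \<in> gensub gens"
proof -
  consider "s = Ztens rk q a b c d" | x where "x \<in> letters" "s = delta [x]"
    using assms(1) by (auto simp: gens_eq)
  then show ?thesis
  proof cases
    case 1
    have "lder Y Z \<in> gensub gens"
      unfolding gensub_def ext[OF lder_Z[OF assms(2)]] mult.assoc
      by (intro spanK_add spanK_smul omegaw_letters[unfolded gensub_def]) (auto simp: letters_def)
    then show ?thesis using 1 nmu_Ztens by simp
  next
    case 2
    have eq: "lder Y (delta [x]) = (\<lambda>t. of_bool (x = Y) * om [] t)"
      by (auto simp: lder_def delta_def)
    have "nmu rk q s = delta [x]" using 2 letters_X by (auto simp: nmu_delta omegaw_single)
    then show ?thesis
      using omegaw_letters[of "[]"] unfolding eq gensub_def by (simp add: eq spanK_smul)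
  qed
qed

theorem gens_left_coideal: "left_coideal_subalg X rk q (gensub gens)"
  by (rule gensub_left_coideal) (fact gens_fins gens_homg gens_lder)+

subsection \<open>The element \<open>Z\<close> is not a polynomial in the letters\<close>

text \<open>The preimage of \<open>z\<close> under \<open>rk d\<close>, written as an image under
  \<open>rk y\<close> so that injectivity of \<open>rk y\<close> separates it from the
  letters.\<close>

definition k where "k = rk y w"

lemma dk: "rk d k = z"
  unfolding k_def using rk_dist[of d y w] dy cd_triple yc allX by simp

lemma k_X: "k \<in> X"
  using allX by (simp add: k_def rk_closed)

lemma w_ne_a: "w \<noteq> a"
  using rk_inj[of c d a] cd ca dist allX by auto

text \<open>Undoing the braidings that lead to \<open>a b c d\<close> can only bring up
  \<open>a\<close>, \<open>w\<close>, \<open>u\<close>, \<open>y\<close>, \<open>z\<close> or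
  \<open>k\<close>; here and below each of them is shown to lie outside
  \<open>letters\<close>.\<close>

lemma a_letters: "a \<notin> letters"
proof -
  have "a \<noteq> e" using rk_inj[of a w a] e_aw rk_idem[of a] w_ne_a allX by auto
  moreover have "a \<noteq> g" using rk_inj[of a d a] g_ad rk_idem[of a] dist allX by auto
  ultimately show ?thesis using dist fa_ne by (auto simp: letters_def)
qed

lemma w_letters: "w \<notin> letters"
proof -
  have "w \<noteq> f" using rk_inj[of b w d] bw f_bd w_ne allX by auto
  moreover have "w \<noteq> g" using cd_triple ad_triple dist by auto
  ultimately show ?thesis using w_ne w_ne_e by (auto simp: letters_def)
qed

lemma y_letters: "y \<notin> letters"
proof -
  have "y \<noteq> b" using noncomm ab by simp
  moreover have "y \<noteq> c" using rk_inj[of a b c] ab ac dist allX by auto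
  moreover have "y \<noteq> d" using ab_triple f_bd fa_ne by auto
  moreover have "y \<noteq> e" using rk_inj[of a b w] ab e_aw w_ne allX by auto
  moreover have "b \<noteq> f" using rk_inj[of b d b] f_bd rk_idem[of b] dist allX by auto
  then have "y \<noteq> f" using rk_inj[of a b f] ab af allX by auto
  ultimately show ?thesis using y_ne_g by (auto simp: letters_def)
qed

lemma k_ne_c: "k \<noteq> c"
proof
  assume "k = c"
  moreover have "rk y (rk c y) = c" using rk_braid[of y c] yc z_ne_c allX by simp
  ultimately have "rk c y = w"
    using rk_inj[of y "rk c y" w] allX rk_closed[of c y] by (simp add: k_def)
  then have "y = d" using rk_inj[of c y d] cd allX by simp
  then show False using y_letters by (simp add: letters_def)
qed

lemma u_letters: "u \<notin> letters"
proof -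
  have "u \<noteq> b" using rk_inj[of b c b] bc rk_idem[of b] dist allX by auto
  moreover have "u \<noteq> d" using bc_triple cd w_ne by auto
  moreover have "u \<noteq> g" using du ad_triple a_letters by (auto simp: letters_def)
  \<comment> \<open>If \<open>u = e\<close>, then \<open>z = rk f u\<close>, which is the image of
    \<open>rk d c\<close> under \<open>rk b\<close>. As \<open>b\<close> fixes \<open>z\<close>,
    this forces \<open>rk d c = z = rk d k\<close>, hence \<open>k = c\<close>.\<close>
  moreover have "u \<noteq> e"
  proof
    assume "u = e"
    then have "rk b (rk d c) = z" using ez_triple rk_dist[of b d c] f_bd bc allX by simp
    moreover have "rk b z = z" using rk_dist[of b y c] yc ab_triple bc au allX by simp
    ultimately have "rk d c = z" using rk_inj[of b "rk d c" z] allX rk_closed[of d c] by simp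
    then have "k = c" using rk_inj[of d k c] dk k_X allX by simp
    then show False using k_ne_c by simp
  qed
  ultimately show ?thesis using u_ne_c u_ne_f by (auto simp: letters_def)
qed

lemma z_letters: "z \<notin> letters"
proof -
  have "z \<noteq> b"
  proof
    assume "z = b"
    then have "rk a u = rk a (rk b a)" using au rk_braid[of a b] noncomm allX by simp
    then have "rk b c = rk b a" using rk_inj[of a u "rk b a"] bc allX rk_closed[of b a] by simp
    then show False using rk_inj[of b c a] dist allX by auto
  qed
  moreover have "z \<noteq> d"
  proof
    assume "z = d"
    then have "rk a u = rk a (rk d a)" using au rk_braid[of a d] noncomm allX by simp
    then have "u = rk d a" using rk_inj[of a u "rk d a"] allX rk_closed[of d a] by simp
    then have "rk d a = a" using du rk_inj[of d "rk d a" a] allX rk_closed[of d a] by simp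
    then show False using rk_comm[of d a] noncomm allX by simp
  qed
  moreover have "u \<noteq> w" using rk_inj[of b c w] bc bw w_ne allX by auto
  then have "z \<noteq> e" using rk_inj[of a u w] au e_aw allX by auto
  moreover have "z \<noteq> g" using rk_inj[of a u d] au g_ad u_letters allX by (auto simp: letters_def)
  ultimately show ?thesis using z_ne_c z_ne_f by (auto simp: letters_def)
qed

lemma k_letters: "k \<notin> letters"
proof -
  have inj: "rk y w = rk y v \<Longrightarrow> v \<in> X \<Longrightarrow> w = v" for v using rk_inj[of y w v] allX by simp
  have ye: "rk y e = e" using rk_comm[of e y] ey allX by simp
  have "k \<noteq> b" using inj[of a] ab_triple w_ne_a allX by (auto simp: k_def)
  moreover have "k \<noteq> d" using inj[of d] yd w_ne allX by (auto simp: k_def)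
  moreover have "k \<noteq> e" using inj[of e] ye w_ne_e allX by (auto simp: k_def)
  moreover have "k \<noteq> f" using inj[of g] fy_triple w_letters allX by (auto simp: k_def letters_def)
  moreover have "k \<noteq> g"
  proof
    assume "k = g"
    then have "rk a u = rk a a" using dk ad_triple au rk_idem[of a] allX by simp
    then have "u = a" using rk_inj[of a u a] allX by simp
    then show False using bc_triple ca dist by simp
  qed
  ultimately show ?thesis using k_ne_c by (auto simp: letters_def)
qed

lemma omegaw_ab_nonzero:
  assumes "set v \<subseteq> X" "om v [a, b] \<noteq> 0" shows "v = [a, b] \<or> v = [b, y]"
proof -
  obtain v1 v2 where v: "v = v1 @ b # v2" "om (v1 @ map (rk b) v2) ([] @ [a]) \<noteq> 0"
    using omegaw_snoc_nonzero[of v "[a]" b] assms by auto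
  have X: "set (v1 @ map (rk b) v2) \<subseteq> X" using assms(1) v(1) allX rk_closed by auto
  have "length (v1 @ map (rk b) v2) = 1" using omegaw_length[OF X v(2)] by simp
  moreover obtain w1 w2 where "v1 @ map (rk b) v2 = w1 @ a # w2"
    using omegaw_snoc_nonzero[OF X v(2)] by blast
  ultimately have "v1 @ map (rk b) v2 = [a]" by (cases w1) auto
  then consider "v1 = [a]" "v2 = []" | s where "v1 = []" "v2 = [s]" "rk b s = a"
    by (auto simp: append_eq_Cons_conv)
  then show ?thesis
  proof cases
    case 2
    then have "s = y" using rk_inj[of b s y] ab_triple assms(1) v(1) allX by auto
    then show ?thesis using 2 v by simp
  qed (use v in simp)
qed

text \<open>If \<open>c\<close> is last, removing it leaves \<open>a b\<close> or
  \<open>b y\<close>. Otherwise \<open>rk c\<close> sends the last letter to \<open>b\<close> or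
  \<open>y\<close>, so that letter is \<open>u\<close> or \<open>z\<close>.\<close>

lemma omegaw_abc_nonzero:
  assumes "set v \<subseteq> X" "om v [a, b, c] \<noteq> 0"
  shows "v = [a, b, c] \<or> u \<in> set v \<or> y \<in> set v \<or> z \<in> set v"
proof -
  obtain v1 v2 where v: "v = v1 @ c # v2" "om (v1 @ map (rk c) v2) [a, b] \<noteq> 0"
    using omegaw_snoc_nonzero[of v "[a, b]" c] assms by auto
  have X: "set (v1 @ map (rk c) v2) \<subseteq> X" using assms(1) v(1) allX rk_closed by auto
  have cz: "rk c z = y" using braid_triple[of y c] yc z_ne_c allX by simp
  show ?thesis
  proof (cases v2 rule: rev_cases)
    case Nil
    then show ?thesis using omegaw_ab_nonzero[OF X v(2)] v(1) by auto
  next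
    case (snoc v2' s)
    then have s: "s \<in> X" using assms(1) v(1) by auto
    have "rk c s = b \<or> rk c s = y" using omegaw_ab_nonzero[OF X v(2)] snoc by auto
    then have "s = u \<or> s = z" using rk_inj[of c s] bc_triple cz s allX by metis
    then show ?thesis using snoc v(1) by auto
  qed
qed

lemma omegaw_letters_abcd:
  assumes "set v \<subseteq> letters" shows "om v [a, b, c, d] = 0"
proof (rule ccontr)
  assume "om v [a, b, c, d] \<noteq> 0"
  then obtain v1 v2 where v: "v = v1 @ d # v2" "om (v1 @ map (rk d) v2) [a, b, c] \<noteq> 0"
    using omegaw_snoc_nonzero[of v "[a, b, c]" d] assms letters_X by auto
  have X: "set (v1 @ map (rk d) v2) \<subseteq> X" using assms v(1) letters_X allX rk_closed by auto
  have v1: "s \<in> letters" if "s \<in> set v1" for s using assms v(1) that by auto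
  have v2: "rk d s \<notin> {c, u, y, z}" if "s \<in> set v2" for s
  proof -
    have s: "s \<in> letters" "s \<in> X" using assms v(1) letters_X that by auto
    then show ?thesis
      using rk_inj[of d s] cd_triple du dy dk w_letters u_letters y_letters k_letters allX k_X
      by (metis insertE singletonD)
  qed
  have "t \<notin> set (v1 @ map (rk d) v2)" if "t \<in> {u, y, z}" for t
    unfolding set_append set_map using that v1 v2 u_letters y_letters z_letters by blast
  then have eq: "v1 @ map (rk d) v2 = [a, b, c]"
    using omegaw_abc_nonzero[OF X v(2)] by blast
  show False
  proof (cases v2 rule: rev_cases)
    case Nil
    then show ?thesis using eq v1[of a] a_letters by simp
  next
    case (snoc v2' s)
    then show ?thesis using eq v2[of s] by auto
  qed
qed

text \<open>Undoing the last letter \<open>d\<close> must leave a word containing \<open>c\<close>.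
  In the three rotated words the only candidate for \<open>d\<close> is \<open>e\<close>, and then
  \<open>c\<close> can only be \<open>f\<close>; the assumption excludes having both.\<close>

lemma Z_abcd:
  assumes "e \<noteq> d \<or> f \<noteq> c \<or> g \<noteq> b" shows "Z [a, b, c, d] = 1"
proof -
  have fgd: "f \<noteq> d" "g \<noteq> d" using f_bd g_ad noncomm by auto
  \<comment> \<open>With \<open>e = d\<close>, both \<open>g\<close> and \<open>rk d c\<close> are
    sent to \<open>d\<close> by \<open>rk c\<close>, so they agree; with \<open>f = c\<close> the
    latter equals \<open>b\<close>.\<close>
  have imp: "g = b" if "e = d" "f = c"
  proof -
    have "rk c g = rk c (rk d c)" using cg that(1) rk_braid[of c d] noncomm allX by simp
    then have "g = rk d c" using rk_inj[of c g "rk d c"] allX rk_closed[of d c] by simp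
    then show ?thesis using bd_triple that(2) by simp
  qed
  have c_ne: "rk d a \<noteq> c" "rk d b \<noteq> c" "rk d c \<noteq> c"
    using rk_inj[of d a w] rk_inj[of d b w] rk_inj[of d c w] cd_triple w_ne w_ne_a allX by auto
  have "c \<noteq> g" using rk_inj[of a d c] g_ad ac dist allX by auto
  have zero: "om v [a, b, c, d] = 0"
    if vX: "set v \<subseteq> X"
      and vc: "\<And>v1 v2. v = v1 @ d # v2 \<Longrightarrow> c \<notin> set v1 \<and> c \<notin> rk d ` set v2" for v
  proof (rule ccontr)
    assume "om v [a, b, c, d] \<noteq> 0"
    then obtain v1 v2 where v: "v = v1 @ d # v2" "om (v1 @ map (rk d) v2) [a, b, c] \<noteq> 0"
      using omegaw_snoc_nonzero[of v "[a, b, c]" d] vX by auto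
    have X: "set (v1 @ map (rk d) v2) \<subseteq> X" using vX v(1) allX rk_closed by auto
    obtain w1 w2 where "v1 @ map (rk d) v2 = w1 @ c # w2"
      using omegaw_snoc_nonzero[OF X, of "[a, b]" c] v(2) by auto
    then have "c \<in> set (v1 @ map (rk d) v2)" by simp
    then show False using vc[OF v(1)] by auto
  qed
  have 1: "om [a, b, c, d] [a, b, c, d] = 1"
    using omegaw_snoc_same[of "[a, b, c]" d "[a, b, c]"] omegaw_snoc_same[of "[a, b]" c "[a, b]"]
      omegaw_snoc_same[of "[a]" b "[a]"] allX dist by (simp add: omegaw_single delta_def)
  have 2: "om [e, a, b, c] [a, b, c, d] = 0"
    by (rule zero) (use allX dist c_ne in \<open>auto simp: Cons_eq_append_conv\<close>)
  have 3: "om [f, e, a, b] [a, b, c, d] = 0"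
    by (rule zero) (use allX dist c_ne fgd assms imp in \<open>auto simp: Cons_eq_append_conv\<close>)
  have 4: "om [g, f, e, a] [a, b, c, d] = 0"
    by (rule zero) (use allX dist c_ne fgd assms imp \<open>c \<noteq> g\<close> in \<open>auto simp: Cons_eq_append_conv\<close>)
  show ?thesis by (simp add: Z_def 1 2 3 4)
qed

text \<open>No generator has a constant term and \<open>Z\<close> lives in degree four, so the
  one-letter part of a product can only come from a letter. Degree-one elements of the subalgebra
  thus involve no other letters.\<close>

lemma gensub_degree_one:
  assumes "p \<in> gensub gens" "p [x] \<noteq> 0" shows "x \<in> letters"
  using assms unfolding gensub_def
proof (induction rule: spanK_induct)
  case (step h p s)
  then obtain ws where ws: "h = nmu rk q (tensl ws)" "set ws \<subseteq> gens" by blast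
  show ?case
  proof (cases "p [x] = 0")
    case False
    then show ?thesis by (rule step.IH)
  next
    case True
    then have h: "h [x] \<noteq> 0" using step.prems by auto
    show ?thesis
    proof (cases ws)
      case Nil
      then show ?thesis
        using h ws nmu_tensl_Nil[where S = gens, OF gens_fins gens_homg] by (simp add: delta_def)
    next
      case (Cons s ws')
      have Zs: "Z [] = 0" "Z [x] = 0"
        using homg_support[OF Z_homg, of "[]"] homg_support[OF Z_homg, of "[x]"] by auto
      have "nmu rk q s [] * nmu rk q (tensl ws') [x] + nmu rk q s [x] * nmu rk q (tensl ws') [] \<noteq> 0"
        using h ws nmu_tensl_Cons[where S = gens and s = s and ws = ws', OF gens_fins gens_homg] Cons by (simp add: qsh_letter)
      moreover have "s = Ztens rk q a b c d \<or> (\<exists>x'\<in>letters. s = delta [x'])"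
        using ws(2) Cons by (auto simp: gens_eq)
      moreover have "nmu rk q (delta [x']) = delta [x']" if "x' \<in> letters" for x'
        using that letters_X by (auto simp: nmu_delta omegaw_single)
      moreover have "delta [x'] [] = (0::'b)" "delta [x'] [x] \<noteq> (0::'b) \<Longrightarrow> x = x'" for x'
        by (auto simp: delta_def split: if_splits)
      ultimately show ?thesis
        using Zs nmu_Ztens by fastforce
    qed
  qed
qed simp

theorem gens_not_gen_deg_one:
  assumes "e \<noteq> d \<or> f \<noteq> c \<or> g \<noteq> b" shows "\<not> gen_deg_one rk q (gensub gens)"
proof
  assume "gen_deg_one rk q (gensub gens)"
  moreover have "Z \<in> gensub gens"
    using nmu_gensub[where S = gens and s = "Ztens rk q a b c d", OF gens_fins gens_homg] nmu_Ztens by (simp add: gens_eq)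
  ultimately have "Z \<in> spanK {nmu rk q (tensl ws) | ws.
      set ws \<subseteq> {h \<in> gensub gens. \<forall>u. h u \<noteq> 0 \<longrightarrow> length u = 1}}"
    unfolding gen_deg_one_def by simp
  then have "Z [a, b, c, d] = 0"
  proof (induction rule: spanK_induct)
    case (step h p s)
    then obtain ws where ws: "h = nmu rk q (tensl ws)"
      "set ws \<subseteq> {h \<in> gensub gens. \<forall>u. h u \<noteq> 0 \<longrightarrow> length u = 1}" by blast
    have deg1: "set v \<subseteq> letters" if "r \<in> set ws" "r v \<noteq> 0" for r v
    proof -
      have r: "r \<in> gensub gens" "length v = 1" using that ws(2) by auto
      then obtain x where "v = [x]" by (auto simp: length_Suc_conv)
      then show ?thesis using gensub_degree_one[OF r(1)] that(2) by simp
    qed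
    have "tensl ws v * om v [a, b, c, d] = 0" for v
      using tensl_nonzero[of ws v letters] deg1 omegaw_letters_abcd[of v] by (cases "tensl ws v = 0") auto
    then have "h [a, b, c, d] = 0" unfolding ws(1) nmu_decomp by (intro sum.neutral) blast
    then show ?case using step.IH by simp
  qed simp
  then show False using Z_abcd[OF assms] by simp
qed

end

section \<open>Conjugation in a group as a rack operation\<close>

lemma (in group) rconj_hom:
  assumes "x \<in> carrier G" "y \<in> carrier G" "z \<in> carrier G"
  shows "rconj G x (rconj G y z) = rconj G (rconj G x y) (rconj G x z)"
proof -
  have "inv x \<otimes> (x \<otimes> t) = t" if "t \<in> carrier G" for t
    using assms that by (simp add: m_assoc[symmetric])
  then show ?thesis using assms by (simp add: rconj_def inv_mult_group m_assoc)
qed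

lemma (in group) rconj_inv:
  assumes "x \<in> carrier G" "y \<in> carrier G"
  shows "rconj G x (rconj G (inv x) y) = y" "rconj G (inv x) (rconj G x y) = y"
proof -
  have 1: "x \<otimes> (inv x \<otimes> t) = t" "inv x \<otimes> (x \<otimes> t) = t" if "t \<in> carrier G" for t
    using assms that by (simp_all add: m_assoc[symmetric])
  show "rconj G x (rconj G (inv x) y) = y" "rconj G (inv x) (rconj G x y) = y"
    using assms by (simp_all add: rconj_def m_assoc 1)
qed

lemma (in group) rconj_comm:
  assumes "x \<in> carrier G" "y \<in> carrier G" "rconj G x y = y"
  shows "rconj G y x = x"
proof -
  have "x \<otimes> y = y \<otimes> x" using assms by (simp add: rconj_def inv_solve_right')
  then show ?thesis using assms(1,2) by (simp add: rconj_def m_assoc flip: \<open>x \<otimes> y = y \<otimes> x\<close>)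
qed

theorem mainTheorem13:
  fixes G :: "('g, 'm) monoid_scheme" and X :: "'g set"
    and q :: "'g \<Rightarrow> 'g \<Rightarrow> 'k::field_char_0"
    and a b c d e f g :: 'g and C :: "('g list \<Rightarrow> 'k) set"
  assumes algclosed: "\<forall>p :: 'k poly. degree p \<noteq> 0 \<longrightarrow> (\<exists>x. poly p x = 0)"
    and grp: "group G" and XG: "X \<subseteq> carrier G"
    and Xconj: "\<forall>x\<in>X. \<forall>h\<in>carrier G. h \<otimes>\<^bsub>G\<^esub> x \<otimes>\<^bsub>G\<^esub> inv\<^bsub>G\<^esub> h \<in> X"
    and braided: "\<forall>x\<in>X. \<forall>y\<in>X. rconj G x y = y \<or> rconj G x (rconj G y x) = y"
    and cocyc: "twococycle X (rconj G) q"
    and slim: "slim2 X (rconj G) q"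
    and abcd: "a \<in> X" "b \<in> X" "c \<in> X" "d \<in> X"
    and dist: "a \<noteq> b" "a \<noteq> c" "a \<noteq> d" "b \<noteq> c" "b \<noteq> d" "c \<noteq> d"
    and noncomm: "rconj G a b \<noteq> b" "rconj G a d \<noteq> d" "rconj G b c \<noteq> c"
                 "rconj G b d \<noteq> d" "rconj G c d \<noteq> d"
    and ac: "rconj G a c = c"
    and h1: "rconj G b (rconj G c d) = rconj G c d" "rconj G c d \<noteq> b"
    and h2: "rconj G a (rconj G b d) = rconj G b d" "rconj G b d \<noteq> a"
    and e_def: "e = rconj G a (rconj G b (rconj G c d))"
    and f_def: "f = rconj G e (rconj G a (rconj G b c))"
    and g_def: "g = rconj G f (rconj G e (rconj G a b))"
    and C_def: "C = spanK {nmu (rconj G) q (tensl ws) | ws.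
                 set ws \<subseteq> {Ztens (rconj G) q a b c d, delta [b], delta [c], delta [d],
                            delta [e], delta [f], delta [g]}}"
  shows "left_coideal_subalg X (rconj G) q C
       \<and> ((e \<noteq> d \<or> f \<noteq> c \<or> g \<noteq> b) \<longrightarrow> \<not> gen_deg_one (rconj G) q C)"
proof -
  interpret group G by (rule grp)
  have XD: "x \<in> carrier G" if "x \<in> X" for x using XG that by blast
  have conj: "rconj G h x \<in> X" if "x \<in> X" "h \<in> carrier G" for x h
    using Xconj that by (simp add: rconj_def)
  interpret slim_quadruple X "rconj G" q a b c d e f g
  proof
    fix x y z assume xy: "x \<in> X" "y \<in> X"
    show "rconj G x y \<in> X" using conj xy XD by blast
    show "q x y \<noteq> 0" using cocyc xy by (simp add: twococycle_def)
    show "rconj G x y = y \<Longrightarrow> rconj G y x = x" using rconj_comm XD xy by blast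
    show "rconj G x y \<noteq> y \<Longrightarrow> rconj G x (rconj G y x) = y" using braided xy by blast
    assume z: "z \<in> X"
    show "rconj G x (rconj G y z) = rconj G (rconj G x y) (rconj G x z)"
      using rconj_hom XD xy z by blast
    show "rconj G x y = rconj G x z \<Longrightarrow> y = z" using rconj_inv(2) XD xy z by metis
    show "q (rconj G x y) (rconj G x z) * q x z = q x (rconj G y z) * q y z"
      using cocyc xy z by (simp add: twococycle_def)
  next
    fix x z assume xz: "x \<in> X" "z \<in> X"
    show "\<exists>y\<in>X. rconj G x y = z"
      using rconj_inv(1) conj[of z "inv\<^bsub>G\<^esub> x"] XD xz by (intro bexI[of _ "rconj G (inv\<^bsub>G\<^esub> x) z"]) auto
  next
    fix x assume "x \<in> X"
    then show "rconj G x x = x" using XD[of x] by (simp add: rconj_def m_assoc)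
  qed (fact slim abcd dist noncomm ac h1 h2 e_def f_def g_def)+
  have "C = gensub gens" unfolding C_def gensub_def gens_def ..
  then show ?thesis using gens_left_coideal gens_not_gen_deg_one by simp
qed

end
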